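(* The monoid $\mathsf{tfl}\mathcal{RM}^{\mathsf{fin}}_2$ is the set of input-output functions of acyclic boolean circuits, extended to right-ideal morphisms of $\{0,1\}^*$. And $\mathsf{tfl}\mathcal{RM}^{\mathsf{fin}}_2$ has a generating set $\Gamma\cup\tau$, where $\Gamma$ is finite. The finite set $\Gamma$ can be chosen to be $\{\text{not},\text{and},\text{or},\text{fork}\}$.
   Context: Strings are over $\{0,1\}$. A prefix code is a set of strings none of which is a proper prefix of another. A right ideal of $\{0,1\}^*$ is a set $R$ with $R=R\{0,1\}^*$; it equals $P\{0,1\}^*$ for a unique prefix code $P$. A right-ideal morphism is a partial function $f:\{0,1\}^*\to\{0,1\}^*$ whose domain is a right ideal and such that $f(xu)=f(x)u$ for all $x\in\mathrm{Dom}(f)$, $u\in\{0,1\}^*$; $\mathrm{domC}(f)$ and $\mathrm{imC}(f)$ are the prefix codes of the right ideals $\mathrm{Dom}(f)$ and $\mathrm{Im}(f)$. $\mathsf{tfl}\mathcal{RM}^{\mathsf{fin}}_2$ is the monoid (under composition) of right-ideal morphisms $f$ such that $\mathrm{domC}(f)=\{0,1\}^m$ for some $m\ge0$, and $|x_1|=|x_2|$ implies $|f(x_1)|=|f(x_2)|$ for all $x_1,x_2\in\mathrm{Dom}(f)$; then $f(\mathrm{domC}(f))=\mathrm{imC}(f)\subseteq\{0,1\}^n$ for some $n\ge0$ ($m,n$ depend on $f$). $\tau=\{\tau_{i,j}:1\le i<j\}$, where $\tau_{i,j}$ is the right-ideal morphism with domain code $\{0,1\}^j$ exchanging the bits at positions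 $i$ and $j$. As right-ideal morphisms the gates are: $\text{not}(x_1v)=\overline{x_1}v$; $\text{and}(x_1x_2v)=(x_1\wedge x_2)v$; $\text{or}(x_1x_2v)=(x_1\vee x_2)v$; $\text{fork}(x_1v)=x_1x_1v$ ($x_i\in\{0,1\}$, $v\in\{0,1\}^*$). An acyclic boolean circuit is a directed acyclic graph whose sources are labeled by input variables (fan-out 1), sinks by output variables (fan-in 1), and interior vertices by gates not, and, or, fork, with in- and out-degrees matching the gates (not: 1 in, 1 out; and, or: 2 in, 1 out; fork: 1 in, 2 out). Its input-output function $f:\{0,1\}^m\to\{0,1\}^n$ is extended to a right-ideal morphism by $f(xu)=f(x)u$ for $x\in\{0,1\}^m$, $u\in\{0,1\}^*$.
   Formalization: The first and third sentences are stated for the elements with m = 0 if and only if n = 0; the others, such as v ↦ 0v (m = 0, n = 1) and x₁v ↦ v (m = 1, n = 0), are neither circuit functions nor generated by not, and, or, fork and τ. *)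

theory Defs
  imports "HOL-Library.Sublist" "Graph_Theory.Digraph"
begin

section \<open>Right-ideal morphisms\<close>

definition right_ideal :: "bool list set \<Rightarrow> bool" where
  "right_ideal R \<longleftrightarrow> R = {x @ u |x u. x \<in> R}"

definition prefix_code :: "bool list set \<Rightarrow> bool" where
  "prefix_code P \<longleftrightarrow> (\<forall>x\<in>P. \<forall>y\<in>P. \<not> strict_prefix x y)"

definition ideal_code :: "bool list set \<Rightarrow> bool list set" where
  "ideal_code R = (THE P. prefix_code P \<and> R = {x @ u |x u. x \<in> P})"

lemma subset_ideal: "R \<subseteq> {x @ u |x u. x \<in> R}"
proof
  fix x assume "x \<in> R"
  moreover have "x = x @ []" by simp
  ultimately show "x \<in> {x @ u |x u. x \<in> R}" by blast
qed

lemma ideal_code_ex1: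
  assumes "right_ideal R"
  shows "\<exists>!P. prefix_code P \<and> R = {x @ u |x u. x \<in> P}"
proof (rule ex_ex1I)
  define P where "P = {x \<in> R. \<forall>y\<in>R. \<not> strict_prefix y x}"
  have min: "\<exists>p\<in>P. prefix p x" if "x \<in> R" for x
    using that
  proof (induction x rule: length_induct)
    case (1 x)
    show ?case
    proof (cases "x \<in> P")
      case False
      then obtain y where y: "y \<in> R" "strict_prefix y x"
        using 1(2) by (auto simp: P_def)
      then have "\<exists>p\<in>P. prefix p y"
        using 1(1) prefix_length_less by blast
      with y show ?thesis
        by (meson prefix_order.less_imp_le prefix_order.order_trans)
    qed auto
  qed
  have "prefix_code P"
    by (auto simp: prefix_code_def P_def)
  moreover have "R = {x @ u |x u. x \<in> P}"
  proof
    show "R \<subseteq> {x @ u |x u. x \<in> P}"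
      using min by (fastforce simp: prefix_def)
    show "{x @ u |x u. x \<in> P} \<subseteq> R"
      using assms unfolding right_ideal_def P_def by blast
  qed
  ultimately show "\<exists>P. prefix_code P \<and> R = {x @ u |x u. x \<in> P}" by blast
next
  have sub: "P \<subseteq> Q"
    if P: "prefix_code P" "R = {x @ u |x u. x \<in> P}"
      and Q: "prefix_code Q" "R = {x @ u |x u. x \<in> Q}" for P Q
  proof
    fix p assume p: "p \<in> P"
    then have "p \<in> R" using P(2) subset_ideal[of P] by blast
    then obtain q u where q: "q \<in> Q" "p = q @ u" unfolding Q(2) by blast
    then have "q \<in> R" using Q(2) subset_ideal[of Q] by blast
    then obtain p' u' where p': "p' \<in> P" "q = p' @ u'" unfolding P(2) by blast
    have "prefix p' p" using q p' by simp
    then have "p' = p" using P(1) p p' unfolding prefix_code_def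
      by (auto simp: strict_prefix_def)
    then show "p \<in> Q" using q p' by simp
  qed
  show "P = Q"
    if "prefix_code P \<and> R = {x @ u |x u. x \<in> P}"
      and "prefix_code Q \<and> R = {x @ u |x u. x \<in> Q}" for P Q
    using sub[of P Q] sub[of Q P] that by blast
qed

definition right_ideal_morphism :: "(bool list \<rightharpoonup> bool list) \<Rightarrow> bool" where
  "right_ideal_morphism f \<longleftrightarrow>
     right_ideal (dom f) \<and> (\<forall>x\<in>dom f. \<forall>u. f (x @ u) = Some (the (f x) @ u))"

definition domC :: "(bool list \<rightharpoonup> bool list) \<Rightarrow> bool list set" where
  "domC f = ideal_code (dom f)"

definition imC :: "(bool list \<rightharpoonup> bool list) \<Rightarrow> bool list set" where
  "imC f = ideal_code (ran f)"

definition tflRM :: "(bool list \<rightharpoonup> bool list) set" where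
  "tflRM = {f. right_ideal_morphism f
     \<and> (\<exists>m. domC f = {x. length x = m})
     \<and> (\<forall>x\<in>dom f. \<forall>y\<in>dom f. length x = length y
          \<longrightarrow> length (the (f x)) = length (the (f y)))}"


section \<open>Generation, and the generators\<close>

text \<open>The monoid operation is composition of partial functions; its unit is \<^term>\<open>Some\<close>,
  the identity function.\<close>

inductive_set generated_monoid ::
    "(bool list \<rightharpoonup> bool list) set \<Rightarrow> (bool list \<rightharpoonup> bool list) set"
  for A :: "(bool list \<rightharpoonup> bool list) set" where
  unit: "Some \<in> generated_monoid A"
| gen: "f \<in> A \<Longrightarrow> f \<in> generated_monoid A"
| comp: "f \<in> generated_monoid A \<Longrightarrow> g \<in> generated_monoid A \<Longrightarrow> f \<circ>\<^sub>m g \<in> generated_monoid A"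

fun not_gate :: "bool list \<rightharpoonup> bool list" where
  "not_gate (x # v) = Some ((\<not> x) # v)"
| "not_gate v = None"

fun and_gate :: "bool list \<rightharpoonup> bool list" where
  "and_gate (x # y # v) = Some ((x \<and> y) # v)"
| "and_gate v = None"

fun or_gate :: "bool list \<rightharpoonup> bool list" where
  "or_gate (x # y # v) = Some ((x \<or> y) # v)"
| "or_gate v = None"

fun fork_gate :: "bool list \<rightharpoonup> bool list" where
  "fork_gate (x # v) = Some (x # x # v)"
| "fork_gate v = None"

text \<open>Positions \<open>i < j\<close> count from 1, list indices from 0.\<close>

definition transposition :: "nat \<Rightarrow> nat \<Rightarrow> bool list \<rightharpoonup> bool list" where
  "transposition i j x =
     (if j \<le> length x then Some (x[i - 1 := x ! (j - 1), j - 1 := x ! (i - 1)]) else None)"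

definition transpositions :: "(bool list \<rightharpoonup> bool list) set" where
  "transpositions = {transposition i j |i j. 1 \<le> i \<and> i < j}"


section \<open>Acyclic boolean circuits\<close>

datatype vertex_label = Input nat | Output nat | NotGate | AndGate | OrGate | ForkGate

fun in_arity :: "vertex_label \<Rightarrow> nat" where
  "in_arity (Input i) = 0"
| "in_arity (Output j) = 1"
| "in_arity NotGate = 1"
| "in_arity AndGate = 2"
| "in_arity OrGate = 2"
| "in_arity ForkGate = 1"

fun out_arity :: "vertex_label \<Rightarrow> nat" where
  "out_arity (Input i) = 1"
| "out_arity (Output j) = 0"
| "out_arity NotGate = 1"
| "out_arity AndGate = 1"
| "out_arity OrGate = 1"
| "out_arity ForkGate = 2"

text \<open>Every finite digraph is isomorphic to one whose vertices and arcs are natural numbers.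
  Parallel arcs are allowed (both wires of a fork may enter the same gate). The arities make
  the sources exactly the input vertices and the sinks exactly the output vertices; the variables
  are numbered from 0. Since and, or are symmetric, the incoming arcs need no order.\<close>

definition circuit ::
    "(nat, nat) pre_digraph \<Rightarrow> (nat \<Rightarrow> vertex_label) \<Rightarrow> nat \<Rightarrow> nat \<Rightarrow> bool" where
  "circuit G lab m n \<longleftrightarrow>
     fin_digraph G \<and> acyclic (arcs_ends G)
   \<and> (\<forall>v\<in>verts G. in_degree G v = in_arity (lab v) \<and> out_degree G v = out_arity (lab v))
   \<and> bij_betw lab {v \<in> verts G. \<exists>i. lab v = Input i} (Input ` {..<m})
   \<and> bij_betw lab {v \<in> verts G. \<exists>j. lab v = Output j} (Output ` {..<n})"

fun vertex_rule ::
    "(nat, nat) pre_digraph \<Rightarrow> (nat \<Rightarrow> bool) \<Rightarrow> bool list \<Rightarrow> nat \<Rightarrow> vertex_label \<Rightarrow> bool" where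
  "vertex_rule G val x v (Input i) = (x ! i)"
| "vertex_rule G val x v (Output j) = (\<forall>a\<in>in_arcs G v. val (tail G a))"
| "vertex_rule G val x v NotGate = (\<forall>a\<in>in_arcs G v. \<not> val (tail G a))"
| "vertex_rule G val x v AndGate = (\<forall>a\<in>in_arcs G v. val (tail G a))"
| "vertex_rule G val x v OrGate = (\<exists>a\<in>in_arcs G v. val (tail G a))"
| "vertex_rule G val x v ForkGate = (\<forall>a\<in>in_arcs G v. val (tail G a))"

text \<open>\<open>val v\<close> is the bit that vertex \<open>v\<close> emits on each of its outgoing arcs (for an output vertex,
  the bit it receives). A vertex with in-degree 1 has a single incoming arc, so the universal
  quantifiers in its rule range over one arc.\<close>

definition valuation ::
    "(nat, nat) pre_digraph \<Rightarrow> (nat \<Rightarrow> vertex_label) \<Rightarrow> bool list \<Rightarrow> (nat \<Rightarrow> bool) \<Rightarrow> bool" where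
  "valuation G lab x val \<longleftrightarrow> (\<forall>v\<in>verts G. val v = vertex_rule G val x v (lab v))"

definition io_function ::
    "(nat, nat) pre_digraph \<Rightarrow> (nat \<Rightarrow> vertex_label) \<Rightarrow> nat \<Rightarrow> bool list \<Rightarrow> bool list" where
  "io_function G lab n x = (THE y. length y = n
     \<and> (\<exists>val. valuation G lab x val \<and> (\<forall>v\<in>verts G. \<forall>j. lab v = Output j \<longrightarrow> y ! j = val v)))"

lemma valuation_ex:
  assumes "circuit G lab m n"
  shows "\<exists>val. valuation G lab x val"
proof -
  interpret fin_digraph G using assms by (simp add: circuit_def)
  have "finite (arcs_ends G)" by (simp add: arcs_ends_def)
  then have wf: "wf (arcs_ends G)"
    using assms by (simp add: circuit_def finite_acyclic_wf)
  define F where "F = (\<lambda>val v. vertex_rule G val x v (lab v))"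
  have "adm_wf (arcs_ends G) F"
    unfolding adm_wf_def
  proof (intro allI impI)
    fix f g :: "nat \<Rightarrow> bool" and v
    assume "\<forall>z. (z, v) \<in> arcs_ends G \<longrightarrow> f z = g z"
    then have "f (tail G a) = g (tail G a)" if "a \<in> in_arcs G v" for a
      using that by (auto simp: arcs_ends_def arc_to_ends_def in_arcs_def)
    then show "F f v = F g v"
      unfolding F_def by (cases "lab v") auto
  qed
  then have "wfrec (arcs_ends G) F = F (wfrec (arcs_ends G) F)"
    using wfrec_fixpoint[OF wf] by metis
  then have "valuation G lab x (wfrec (arcs_ends G) F)"
    unfolding valuation_def by (metis F_def)
  then show ?thesis by blast
qed

lemma valuation_unique:
  assumes "circuit G lab m n" "valuation G lab x val" "valuation G lab x val'" "v \<in> verts G"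
  shows "val v = val' v"
proof -
  interpret fin_digraph G using assms by (simp add: circuit_def)
  have "finite (arcs_ends G)" by (simp add: arcs_ends_def)
  then have wf: "wf (arcs_ends G)"
    using assms by (simp add: circuit_def finite_acyclic_wf)
  show ?thesis
    using wf assms(4)
  proof (induction v rule: wf_induct_rule)
    case (less v)
    then have "val (tail G a) = val' (tail G a)" if "a \<in> in_arcs G v" for a
      using that by (auto simp: arcs_ends_def arc_to_ends_def in_arcs_def)
    then have "vertex_rule G val x v (lab v) = vertex_rule G val' x v (lab v)"
      by (cases "lab v") auto
    then show ?case
      using assms less.prems by (simp add: valuation_def)
  qed
qed

lemma io_function_ex1:
  assumes "circuit G lab m n"
  shows "\<exists>!y. length y = n \<and>
    (\<exists>val. valuation G lab x val \<and> (\<forall>v\<in>verts G. \<forall>j. lab v = Output j \<longrightarrow> y ! j = val v))"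
proof -
  obtain val where val: "valuation G lab x val" using valuation_ex[OF assms] by blast
  have bij: "bij_betw lab {v \<in> verts G. \<exists>j. lab v = Output j} (Output ` {..<n})"
    using assms by (simp add: circuit_def)
  define out where "out j = (THE v. v \<in> verts G \<and> lab v = Output j)" for j
  have out1: "\<exists>!v. v \<in> verts G \<and> lab v = Output j" if "j < n" for j
  proof -
    have "Output j \<in> lab ` {v \<in> verts G. \<exists>j. lab v = Output j}"
      using that bij by (auto simp: bij_betw_def)
    then show ?thesis
      using bij by (fastforce simp: bij_betw_def inj_on_def)
  qed
  have out: "out j \<in> verts G \<and> lab (out j) = Output j" if "j < n" for j
    unfolding out_def using theI'[OF out1[OF that]] .
  have lt: "j < n" if "v \<in> verts G" "lab v = Output j" for v j
  proof -
    have "lab v \<in> Output ` {..<n}"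
      using bij_betwE[OF bij] that by blast
    with that show ?thesis by auto
  qed
  show ?thesis
  proof (rule ex1I[of _ "map (\<lambda>j. val (out j)) [0..<n]"])
    have "map (\<lambda>j. val (out j)) [0..<n] ! j = val v" if "v \<in> verts G" "lab v = Output j" for v j
      using that out[OF lt[OF that]] out1[OF lt[OF that]] lt[OF that] by auto
    with val show "length (map (\<lambda>j. val (out j)) [0..<n]) = n \<and> (\<exists>val'. valuation G lab x val' \<and>
        (\<forall>v\<in>verts G. \<forall>j. lab v = Output j \<longrightarrow> map (\<lambda>j. val (out j)) [0..<n] ! j = val' v))"
      by auto
  next
    fix y assume y: "length y = n \<and> (\<exists>val'. valuation G lab x val' \<and>
        (\<forall>v\<in>verts G. \<forall>j. lab v = Output j \<longrightarrow> y ! j = val' v))"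
    then obtain val' where v': "valuation G lab x val'"
      "\<forall>v\<in>verts G. \<forall>j. lab v = Output j \<longrightarrow> y ! j = val' v" by blast
    show "y = map (\<lambda>j. val (out j)) [0..<n]"
    proof (rule nth_equalityI)
      fix i assume "i < length y"
      then have i: "i < n" using y by simp
      then have "y ! i = val' (out i)" using v'(2) out by blast
      also have "\<dots> = val (out i)"
        using valuation_unique[OF assms val v'(1)] out[OF i] by simp
      finally show "y ! i = map (\<lambda>j. val (out j)) [0..<n] ! i" using i by simp
    qed (use y in simp)
  qed
qed

definition extend_to_morphism :: "nat \<Rightarrow> (bool list \<Rightarrow> bool list) \<Rightarrow> bool list \<rightharpoonup> bool list" where
  "extend_to_morphism m f z = (if m \<le> length z then Some (f (take m z) @ drop m z) else None)"

definition circuit_morphisms :: "(bool list \<rightharpoonup> bool list) set" where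
  "circuit_morphisms =
     {extend_to_morphism m (io_function G lab n) |G lab m n. circuit G lab m n}"


section \<open>The boundary cases\<close>

text \<open>Write \<open>domC f = {0,1}^m\<close> and \<open>imC f \<subseteq> {0,1}^n\<close>. The monoid contains elements with
  \<open>m = 0 < n\<close>, such as \<open>v \<mapsto> 0v\<close>, and with \<open>n = 0 < m\<close>, such as \<open>x\<^sub>1v \<mapsto> v\<close>. No circuit computes
  them, because a nonempty finite acyclic digraph has both a source and a sink. They are not
  generated by the four gates and the transpositions either, because no generator has the empty
  string in its domain or its image. The lemmas below record these facts. The only other element with \<open>m = 0\<close> or \<open>n = 0\<close> is the identity, with \<open>m = n = 0\<close>, which the empty
  circuit computes. The boundary elements are the ones that violate \<open>domC f = {[]} \<longleftrightarrow> imC f = {[]}\<close>.\<close>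

lemma circuit_boundary:
  assumes "circuit G lab m n"
  shows "m = 0 \<longleftrightarrow> n = 0"
proof (cases "verts G = {}")
  case True
  then show ?thesis
    using assms by (simp add: circuit_def bij_betw_def lessThan_empty_iff)
next
  case False
  interpret fin_digraph G using assms by (simp add: circuit_def)
  have fin: "finite (arcs_ends G)" by (simp add: arcs_ends_def)
  have ac: "acyclic (arcs_ends G)"
    and deg: "in_degree G v = in_arity (lab v)" "out_degree G v = out_arity (lab v)"
      if "v \<in> verts G" for v
    using assms that by (auto simp: circuit_def)
  have acyc: "acyclic (arcs_ends G)" using ac False by blast
  obtain v where v: "v \<in> verts G" "\<And>u. (u, v) \<in> arcs_ends G \<Longrightarrow> u \<notin> verts G"
    using wfE_min'[OF finite_acyclic_wf[OF fin acyc] False] by metis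
  have "in_arcs G v = {}"
    using v(2) tail_in_verts by (fastforce simp: in_arcs_def arcs_ends_def arc_to_ends_def)
  then have "in_arity (lab v) = 0" using deg(1)[OF v(1)] by (simp add: in_degree_def)
  then have "\<exists>i. lab v = Input i" by (cases "lab v") auto
  then have "lab v \<in> Input ` {..<m}"
    using assms v(1) bij_betwE[of lab "{v \<in> verts G. \<exists>i. lab v = Input i}" "Input ` {..<m}"]
    by (simp add: circuit_def)
  then have "m \<noteq> 0" by auto
  obtain w where w: "w \<in> verts G" "\<And>u. (u, w) \<in> (arcs_ends G)\<inverse> \<Longrightarrow> u \<notin> verts G"
    using wfE_min'[OF finite_acyclic_wf_converse[OF fin acyc] False] by metis
  have "out_arcs G w = {}"
    using w(2) head_in_verts by (fastforce simp: out_arcs_def arcs_ends_def arc_to_ends_def)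
  then have "out_arity (lab w) = 0" using deg(2)[OF w(1)] by (simp add: out_degree_def)
  then have "\<exists>j. lab w = Output j" by (cases "lab w") auto
  then have "lab w \<in> Output ` {..<n}"
    using assms w(1) bij_betwE[of lab "{v \<in> verts G. \<exists>j. lab v = Output j}" "Output ` {..<n}"]
    by (simp add: circuit_def)
  then have "n \<noteq> 0" by auto
  with \<open>m \<noteq> 0\<close> show ?thesis by simp
qed

lemma generated_no_empty:
  assumes "f \<in> generated_monoid ({not_gate, and_gate, or_gate, fork_gate} \<union> transpositions)"
  shows "f = Some \<or> (f [] = None \<and> [] \<notin> ran f)"
  using assms
proof induction
  case (gen f)
  have "not_gate x \<noteq> Some []" "and_gate x \<noteq> Some []" "or_gate x \<noteq> Some []" "fork_gate x \<noteq> Some []"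
    for x
    by (cases x rule: not_gate.cases, simp_all, cases x rule: and_gate.cases, simp_all,
        cases x rule: or_gate.cases, simp_all, cases x rule: fork_gate.cases, simp_all)
  then have 1: "g [] = None \<and> [] \<notin> ran g" if "g \<in> {not_gate, and_gate, or_gate, fork_gate}" for g
    using that by (auto simp: ran_def)
  have 2: "g [] = None \<and> [] \<notin> ran g" if "g \<in> transpositions" for g
    using that by (auto simp: ran_def transpositions_def transposition_def split: if_splits)
  from gen show ?case
  proof
    assume "f \<in> {not_gate, and_gate, or_gate, fork_gate}"
    then show ?case by (rule disjI2[OF 1])
  next
    assume "f \<in> transpositions"
    then show ?case by (rule disjI2[OF 2])
  qed
next
  case (comp f g)
  have "f \<circ>\<^sub>m Some = f" "Some \<circ>\<^sub>m g = g"
    by (simp_all add: map_comp_def fun_eq_iff split: option.splits)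
  moreover have "ran (f \<circ>\<^sub>m g) \<subseteq> ran f"
    by (auto simp: ran_def map_comp_def split: option.splits)
  moreover have "(f \<circ>\<^sub>m g) [] = None" if "g [] = None"
    using that by simp
  ultimately show ?case
    using comp.IH by (cases "f = Some"; cases "g = Some") auto
qed auto

lemma ideal_code_eq:
  assumes "prefix_code P" "R = {x @ u |x u. x \<in> P}"
  shows "ideal_code R = P"
proof -
  have "right_ideal R"
    unfolding right_ideal_def
  proof
    show "R \<subseteq> {x @ u |x u. x \<in> R}" by (rule subset_ideal)
    show "{x @ u |x u. x \<in> R} \<subseteq> R" unfolding assms(2) by force
  qed
  then show ?thesis
    unfolding ideal_code_def using the1_equality[OF ideal_code_ex1] assms by blast
qed

lemma constant_boundary:
  defines "f \<equiv> \<lambda>v. Some (False # v)"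
  shows "f \<in> tflRM"
    and "f \<notin> generated_monoid ({not_gate, and_gate, or_gate, fork_gate} \<union> transpositions)"
proof -
  have "ideal_code UNIV = {x. length x = 0}"
    by (rule ideal_code_eq) (auto simp: prefix_code_def)
  moreover have "right_ideal UNIV"
    by (auto simp: right_ideal_def)
  ultimately show "f \<in> tflRM"
    by (auto simp: f_def tflRM_def right_ideal_morphism_def domC_def dom_def)
  show "f \<notin> generated_monoid ({not_gate, and_gate, or_gate, fork_gate} \<union> transpositions)"
    using generated_no_empty[of f] by (auto simp: f_def fun_eq_iff)
qed

lemma erasure_boundary:
  defines "f \<equiv> \<lambda>z. if z = [] then None else Some (tl z)"
  shows "f \<in> tflRM"
    and "f \<notin> generated_monoid ({not_gate, and_gate, or_gate, fork_gate} \<union> transpositions)"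
proof -
  have dom: "dom f = {z. z \<noteq> []}"
    by (auto simp: f_def dom_def)
  have R: "{z. z \<noteq> []} = {x @ u |x u. x \<in> {x :: bool list. length x = 1}}"
  proof (intro equalityI subsetI)
    fix z :: "bool list" assume "z \<in> {z. z \<noteq> []}"
    then have "z = [hd z] @ tl z" by simp
    moreover have "[hd z] \<in> {x :: bool list. length x = 1}" by simp
    ultimately show "z \<in> {x @ u |x u. x \<in> {x :: bool list. length x = 1}}" by blast
  qed auto
  have "ideal_code {z. z \<noteq> []} = {x. length x = 1}"
    by (rule ideal_code_eq[OF _ R]) (auto simp: prefix_code_def dest: prefix_length_less)
  moreover have "right_ideal {z. z \<noteq> []}"
    unfolding right_ideal_def
    by (intro equalityI subset_ideal) auto
  ultimately show "f \<in> tflRM"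
    unfolding tflRM_def right_ideal_morphism_def domC_def mem_Collect_eq dom
    by (auto simp: f_def)
  have "f [True] = Some []" by (simp add: f_def)
  then have "[] \<in> ran f" "f \<noteq> Some" by (auto simp: ran_def)
  then show "f \<notin> generated_monoid ({not_gate, and_gate, or_gate, fork_gate} \<union> transpositions)"
    using generated_no_empty[of f] by auto
qed

end

theory Submission
  imports Defs "HOL-Library.Multiset"
begin

text \<open>An element of the monoid is a function from \<open>{0,1}\<^sup>m\<close> to \<open>{0,1}\<^sup>n\<close>, extended to longer
  words, and it satisfies the condition on \<open>domC\<close> and \<open>imC\<close> exactly if \<open>m = 0 \<longleftrightarrow> n = 0\<close>; such an
  element is called balanced below. The balanced elements are closed under composition and contain
  the generators, so everything generated is balanced; and the function of a circuit is balanced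
  because a circuit has inputs if and only if it has outputs.

  For the converse inclusions, consider a state in which finitely many wires carry boolean functions
  of the \<open>m\<close> inputs. Such a state is realizable if it arises from the \<open>m\<close> projections by applying
  gates to the first wires and by exchanging adjacent wires. Two facts meet in this notion. On one
  side every function from \<open>{0,1}\<^sup>m\<close> to \<open>{0,1}\<^sup>n\<close> with \<open>m, n > 0\<close> is the value of a realizable
  state (\<open>realizable_universal\<close>): wires can be permuted and duplicated, so any boolean combination
  of functions on the wires can be added as a new wire; every boolean function is such a combination
  of the projections; and a surplus wire carrying \<open>f\<close> is absorbed by another one carrying \<open>h\<close>, since
  \<open>(\<not> f \<and> f) \<or> h = h\<close>. On the other side, each step that leads to a realizable state is both the
  composition with one generator (\<open>realizable_generated\<close>) and the extension of a circuit by one gate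
  or a renumbering of its open wires (\<open>realizable_open_circuit\<close>).

  The whole monoid is generated once the two boundary effects are available that gates cannot
  produce: a constant bit out of nothing, and the deletion of a bit when no other
  wire is at hand to absorb it.\<close>

section \<open>Normal form of the elements of the monoid\<close>

definition word_map :: "nat \<Rightarrow> nat \<Rightarrow> (bool list \<Rightarrow> bool list) \<Rightarrow> bool" where
  "word_map m n F \<longleftrightarrow> (\<forall>x. length x = m \<longrightarrow> length (F x) = n)"

lemma extend_to_morphism_cong:
  assumes "\<And>x. length x = m \<Longrightarrow> F x = G x"
  shows "extend_to_morphism m F = extend_to_morphism m G"
  using assms by (auto simp: extend_to_morphism_def fun_eq_iff)

lemma extend_to_morphism_append:
  assumes "length x = m"
  shows "extend_to_morphism m F (x @ u) = Some (F x @ u)"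
  using assms by (simp add: extend_to_morphism_def)

lemma dom_extend_to_morphism: "dom (extend_to_morphism m F) = {z. m \<le> length z}"
  by (auto simp: extend_to_morphism_def dom_def)

lemma long_words: "{z :: 'a list. m \<le> length z} = {x @ u |x u. x \<in> {x. length x = m}}"
proof (intro equalityI subsetI)
  fix z :: "'a list" assume "z \<in> {z. m \<le> length z}"
  then have "z = take m z @ drop m z" "length (take m z) = m" by auto
  then show "z \<in> {x @ u |x u. x \<in> {x. length x = m}}" by blast
qed auto

lemma prefix_code_fixed_length:
  assumes "\<And>x. x \<in> P \<Longrightarrow> length x = n"
  shows "prefix_code P"
  unfolding prefix_code_def using assms by (metis less_irrefl prefix_length_less)

lemma ideal_code_long_words: "ideal_code {z. m \<le> length z} = {x. length x = m}"
  by (rule ideal_code_eq[OF _ long_words]) (auto intro: prefix_code_fixed_length)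

lemma domC_extend_to_morphism: "domC (extend_to_morphism m F) = {x. length x = m}"
  by (simp add: domC_def dom_extend_to_morphism ideal_code_long_words)

lemma imC_extend_to_morphism:
  assumes "word_map m n F"
  shows "imC (extend_to_morphism m F) = F ` {x. length x = m}"
  unfolding imC_def
proof (rule ideal_code_eq)
  show "prefix_code (F ` {x. length x = m})"
    using assms by (intro prefix_code_fixed_length[of _ n]) (auto simp: word_map_def)
  show "ran (extend_to_morphism m F) = {x @ u |x u. x \<in> F ` {x. length x = m}}"
  proof (intro equalityI subsetI)
    fix y assume "y \<in> ran (extend_to_morphism m F)"
    then obtain z where "m \<le> length z" "y = F (take m z) @ drop m z"
      by (auto simp: ran_def extend_to_morphism_def split: if_splits)
    then show "y \<in> {x @ u |x u. x \<in> F ` {x. length x = m}}" by force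
  next
    fix y assume "y \<in> {x @ u |x u. x \<in> F ` {x. length x = m}}"
    then obtain x u where "length x = m" "y = F x @ u" by auto
    then show "y \<in> ran (extend_to_morphism m F)"
      using extend_to_morphism_append ranI by metis
  qed
qed

lemma length_eq_code_trivial: "{x :: bool list. length x = m} = {[]} \<longleftrightarrow> m = 0"
proof
  assume eq: "{x :: bool list. length x = m} = {[]}"
  have "replicate m True \<in> {x. length x = m}" by simp
  then show "m = 0" unfolding eq by simp
next
  assume "m = 0"
  then show "{x :: bool list. length x = m} = {[]}" by simp
qed

lemma imC_trivial:
  assumes "word_map m n F"
  shows "imC (extend_to_morphism m F) = {[]} \<longleftrightarrow> n = 0"
proof -
  have len: "length (F x) = n" if "length x = m" for x
    using assms that by (simp add: word_map_def)
  have ne: "length (replicate m True) = m" by simp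
  have "F ` {x. length x = m} = {[]} \<longleftrightarrow> n = 0"
  proof
    assume "F ` {x. length x = m} = {[]}"
    then have "F (replicate m True) = []" using ne by blast
    then show "n = 0" using len[OF ne] by simp
  next
    assume "n = 0"
    then have "F ` {x. length x = m} = (\<lambda>x. []) ` {x :: bool list. length x = m}"
      using len by (intro image_cong) auto
    also have "\<dots> = {[]}" by (rule image_constant[of "replicate m True"]) simp
    finally show "F ` {x. length x = m} = {[]}" .
  qed
  then show ?thesis using imC_extend_to_morphism[OF assms] by simp
qed

text \<open>A right-ideal morphism is determined by its values on its domain code, and the length condition
  makes these values equally long.\<close>

lemma tflRM_iff: "f \<in> tflRM \<longleftrightarrow> (\<exists>m n F. word_map m n F \<and> f = extend_to_morphism m F)"
proof
  assume f: "f \<in> tflRM"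
  then obtain m where m: "domC f = {x. length x = m}" by (auto simp: tflRM_def)
  have rid: "right_ideal (dom f)" and app: "\<And>x u. x \<in> dom f \<Longrightarrow> f (x @ u) = Some (the (f x) @ u)"
    using f by (auto simp: tflRM_def right_ideal_morphism_def)
  have len: "length (the (f x)) = length (the (f y))"
    if "x \<in> dom f" "y \<in> dom f" "length x = length y" for x y
    using f that unfolding tflRM_def by blast
  have "dom f = {x @ u |x u. x \<in> domC f}"
    using theI'[OF ideal_code_ex1[OF rid]] by (simp add: domC_def ideal_code_def)
  then have dom: "dom f = {z. m \<le> length z}"
    unfolding m long_words .
  have "word_map m (length (the (f (replicate m True)))) (\<lambda>x. the (f x))"
    unfolding word_map_def using len dom by simp
  moreover have "f z = extend_to_morphism m (\<lambda>x. the (f x)) z" for z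
  proof (cases "m \<le> length z")
    case True
    then have "take m z \<in> dom f" by (simp add: dom)
    from app[OF this, of "drop m z"] True show ?thesis
      by (simp add: extend_to_morphism_def)
  next
    case False
    then have "z \<notin> dom f" by (simp add: dom)
    with False show ?thesis by (simp add: extend_to_morphism_def domIff)
  qed
  ultimately show "\<exists>m n F. word_map m n F \<and> f = extend_to_morphism m F"
    by (metis ext)
next
  assume "\<exists>m n F. word_map m n F \<and> f = extend_to_morphism m F"
  then obtain m n F where F: "word_map m n F" and f: "f = extend_to_morphism m F" by blast
  have "right_ideal {z :: bool list. m \<le> length z}"
    unfolding right_ideal_def by (intro equalityI subset_ideal) auto
  then show "f \<in> tflRM"
    using F
    by (auto simp: f tflRM_def right_ideal_morphism_def dom_extend_to_morphism
        domC_extend_to_morphism extend_to_morphism_def word_map_def)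
qed

lemma balanced_extend_to_morphism:
  assumes "word_map m n F"
  shows "(domC (extend_to_morphism m F) = {[]} \<longleftrightarrow> imC (extend_to_morphism m F) = {[]})
    \<longleftrightarrow> (m = 0 \<longleftrightarrow> n = 0)"
  by (simp only: imC_trivial[OF assms] domC_extend_to_morphism length_eq_code_trivial)

lemma balancedI:
  assumes "word_map m n F" "m = 0 \<longleftrightarrow> n = 0"
  shows "extend_to_morphism m F \<in> {f \<in> tflRM. domC f = {[]} \<longleftrightarrow> imC f = {[]}}"
proof -
  have "extend_to_morphism m F \<in> tflRM" unfolding tflRM_iff using assms(1) by blast
  then show ?thesis
    unfolding mem_Collect_eq balanced_extend_to_morphism[OF assms(1)] using assms(2) by (rule conjI)
qed

lemma balancedE:
  assumes "f \<in> {f \<in> tflRM. domC f = {[]} \<longleftrightarrow> imC f = {[]}}"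
  obtains m n F where "word_map m n F" "m = 0 \<longleftrightarrow> n = 0" "f = extend_to_morphism m F"
proof -
  note f = conjunct1[OF assms[unfolded mem_Collect_eq]]
    and b = conjunct2[OF assms[unfolded mem_Collect_eq]]
  from f obtain m n F where F: "word_map m n F" "f = extend_to_morphism m F"
    unfolding tflRM_iff by blast
  from b have "m = 0 \<longleftrightarrow> n = 0" unfolding F(2) balanced_extend_to_morphism[OF F(1)] .
  then show thesis by (rule that[OF F(1) _ F(2)])
qed

section \<open>Closure under composition\<close>

text \<open>If \<open>F\<close> yields fewer bits than \<open>G\<close> reads, then \<open>G\<close> also reads \<open>m' - n\<close> bits beyond the argument
  of \<open>F\<close>; if it yields more, then the last \<open>n - m'\<close> of them pass \<open>G\<close> unchanged. Both cases are
  covered by truncated subtraction.\<close>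

lemma comp_extend_to_morphism:
  assumes F: "word_map m n F" and G: "word_map m' n' G"
  obtains H where "word_map (m + (m' - n)) (n' + (n - m')) H"
    and "extend_to_morphism m' G \<circ>\<^sub>m extend_to_morphism m F = extend_to_morphism (m + (m' - n)) H"
proof
  define H where "H = (\<lambda>z. let w = F (take m z) @ drop m z in G (take m' w) @ drop m' w)"
  have lF: "length (F (take m z)) = n" if "m \<le> length z" for z
    using F that by (simp add: word_map_def)
  have lG: "length (G (take m' z)) = n'" if "m' \<le> length z" for z
    using G that by (simp add: word_map_def)
  show "word_map (m + (m' - n)) (n' + (n - m')) H"
    unfolding word_map_def
  proof (intro allI impI)
    fix z :: "bool list" assume z: "length z = m + (m' - n)"
    define w where "w = F (take m z) @ drop m z"
    have w: "length w = n + (m' - n)" by (simp add: w_def lF z)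
    then have "length (G (take m' w)) = n'" by (intro lG) simp
    moreover have "H z = G (take m' w) @ drop m' w" by (simp add: H_def w_def)
    ultimately show "length (H z) = n' + (n - m')" using w by auto
  qed
  show "extend_to_morphism m' G \<circ>\<^sub>m extend_to_morphism m F = extend_to_morphism (m + (m' - n)) H"
  proof
    fix z :: "bool list"
    consider "length z < m" | "m \<le> length z" "length z < m + (m' - n)"
      | x u where "z = x @ u" "length x = m + (m' - n)"
      by (metis append_take_drop_id length_take min.absorb2 not_le)
    then show "(extend_to_morphism m' G \<circ>\<^sub>m extend_to_morphism m F) z
        = extend_to_morphism (m + (m' - n)) H z"
    proof cases
      case 3
      have "m' \<le> length (F (take m x) @ drop m x)" using 3 by (simp add: lF)
      then show ?thesis
        using 3(2) unfolding 3(1) extend_to_morphism_append[OF 3(2)]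
        by (simp add: extend_to_morphism_def H_def lF)
    qed (auto simp: extend_to_morphism_def lF)
  qed
qed

lemma tflRM_comp: "f \<in> tflRM \<Longrightarrow> g \<in> tflRM \<Longrightarrow> f \<circ>\<^sub>m g \<in> tflRM"
  unfolding tflRM_iff by (metis comp_extend_to_morphism)

lemma balanced_comp:
  assumes "f \<in> {f \<in> tflRM. domC f = {[]} \<longleftrightarrow> imC f = {[]}}"
    and "g \<in> {f \<in> tflRM. domC f = {[]} \<longleftrightarrow> imC f = {[]}}"
  shows "f \<circ>\<^sub>m g \<in> {f \<in> tflRM. domC f = {[]} \<longleftrightarrow> imC f = {[]}}"
proof -
  obtain m' n' G where G: "word_map m' n' G" "m' = 0 \<longleftrightarrow> n' = 0" "f = extend_to_morphism m' G"
    using assms(1) by (rule balancedE)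
  obtain m n F where F: "word_map m n F" "m = 0 \<longleftrightarrow> n = 0" "g = extend_to_morphism m F"
    using assms(2) by (rule balancedE)
  obtain H where H: "word_map (m + (m' - n)) (n' + (n - m')) H"
      "f \<circ>\<^sub>m g = extend_to_morphism (m + (m' - n)) H"
    using comp_extend_to_morphism[OF F(1) G(1)] F(3) G(3) by metis
  have "m + (m' - n) = 0 \<longleftrightarrow> n' + (n - m') = 0" using F(2) G(2) by auto
  then show ?thesis unfolding H(2) by (rule balancedI[OF H(1)])
qed

lemma generated_monoid_least:
  assumes "Some \<in> M" "A \<subseteq> M" "\<And>f g. f \<in> M \<Longrightarrow> g \<in> M \<Longrightarrow> f \<circ>\<^sub>m g \<in> M"
  shows "generated_monoid A \<subseteq> M"
proof
  fix f assume "f \<in> generated_monoid A"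
  then show "f \<in> M" using assms by induction auto
qed

lemma unit_balanced: "Some \<in> {f \<in> tflRM. domC f = {[]} \<longleftrightarrow> imC f = {[]}}"
proof -
  have "Some = extend_to_morphism 0 (\<lambda>x. x)"
    by (simp add: extend_to_morphism_def fun_eq_iff)
  then show ?thesis using balancedI[of 0 0 "\<lambda>x. x"] by (simp add: word_map_def)
qed

lemma gates_as_extensions:
  "not_gate = extend_to_morphism 1 (\<lambda>x. [\<not> x ! 0])"
  "and_gate = extend_to_morphism 2 (\<lambda>x. [x ! 0 \<and> x ! 1])"
  "or_gate = extend_to_morphism 2 (\<lambda>x. [x ! 0 \<or> x ! 1])"
  "fork_gate = extend_to_morphism 1 (\<lambda>x. [x ! 0, x ! 0])"
  "1 \<le> i \<Longrightarrow> i < j \<Longrightarrow> transposition i j = extend_to_morphism j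
    (\<lambda>x. x[i - 1 := x ! (j - 1), j - 1 := x ! (i - 1)])"
proof -
  show "not_gate = extend_to_morphism 1 (\<lambda>x. [\<not> x ! 0])"
  proof
    fix z show "not_gate z = extend_to_morphism 1 (\<lambda>x. [\<not> x ! 0]) z"
      by (cases z rule: not_gate.cases) (auto simp: extend_to_morphism_def)
  qed
  show "and_gate = extend_to_morphism 2 (\<lambda>x. [x ! 0 \<and> x ! 1])"
  proof
    fix z show "and_gate z = extend_to_morphism 2 (\<lambda>x. [x ! 0 \<and> x ! 1]) z"
      by (cases z rule: and_gate.cases) (auto simp: extend_to_morphism_def)
  qed
  show "or_gate = extend_to_morphism 2 (\<lambda>x. [x ! 0 \<or> x ! 1])"
  proof
    fix z show "or_gate z = extend_to_morphism 2 (\<lambda>x. [x ! 0 \<or> x ! 1]) z"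
      by (cases z rule: or_gate.cases) (auto simp: extend_to_morphism_def)
  qed
  show "fork_gate = extend_to_morphism 1 (\<lambda>x. [x ! 0, x ! 0])"
  proof
    fix z show "fork_gate z = extend_to_morphism 1 (\<lambda>x. [x ! 0, x ! 0]) z"
      by (cases z rule: fork_gate.cases) (auto simp: extend_to_morphism_def)
  qed
  assume ij: "1 \<le> i" "i < j"
  have prefix: "z[i - 1 := z ! (j - 1), j - 1 := z ! (i - 1)] =
      (take j z)[i - 1 := take j z ! (j - 1), j - 1 := take j z ! (i - 1)] @ drop j z"
    if "j \<le> length z" for z :: "bool list"
  proof -
    obtain x u where z: "z = x @ u" "length x = j"
      by (rule that[of "take j z" "drop j z"]) (use \<open>j \<le> length z\<close> in simp_all)
    moreover have "i - 1 < length x" "j - 1 < length x" using ij z(2) by auto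
    ultimately show ?thesis by (simp add: nth_append list_update_append1)
  qed
  show "transposition i j = extend_to_morphism j
    (\<lambda>x. x[i - 1 := x ! (j - 1), j - 1 := x ! (i - 1)])"
  proof
    fix z show "transposition i j z = extend_to_morphism j
      (\<lambda>x. x[i - 1 := x ! (j - 1), j - 1 := x ! (i - 1)]) z"
    proof (cases "j \<le> length z")
      case True
      then show ?thesis
        unfolding transposition_def extend_to_morphism_def prefix[OF True] by (simp only: if_True)
    next
      case False
      then show ?thesis unfolding transposition_def extend_to_morphism_def by (simp only: if_False)
    qed
  qed
qed

lemma generators_balanced:
  "{not_gate, and_gate, or_gate, fork_gate} \<union> transpositions
    \<subseteq> {f \<in> tflRM. domC f = {[]} \<longleftrightarrow> imC f = {[]}}"
proof
  have *: "extend_to_morphism m F \<in> {f \<in> tflRM. domC f = {[]} \<longleftrightarrow> imC f = {[]}}"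
    if "\<And>x. length x = m \<Longrightarrow> length (F x) = n" "0 < m" "0 < n" for m n F
    using that by (intro balancedI[of m n]) (auto simp: word_map_def)
  fix f assume "f \<in> {not_gate, and_gate, or_gate, fork_gate} \<union> transpositions"
  then consider "f = not_gate" | "f = and_gate" | "f = or_gate" | "f = fork_gate"
    | i j where "1 \<le> i" "i < j" "f = transposition i j"
    by (auto simp: transpositions_def)
  then show "f \<in> {f \<in> tflRM. domC f = {[]} \<longleftrightarrow> imC f = {[]}}"
  proof cases
    case 1 show ?thesis unfolding 1 gates_as_extensions(1) by (rule *[where n = 1]) auto
  next
    case 2 show ?thesis unfolding 2 gates_as_extensions(2) by (rule *[where n = 1]) auto
  next
    case 3 show ?thesis unfolding 3 gates_as_extensions(3) by (rule *[where n = 1]) auto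
  next
    case 4 show ?thesis unfolding 4 gates_as_extensions(4) by (rule *[where n = 2]) auto
  next
    case 5
    show ?thesis unfolding 5(3) gates_as_extensions(5)[OF 5(1,2)]
      using 5 by (intro *[where n = j]) auto
  qed
qed

section \<open>Every boolean function is realizable\<close>

text \<open>The bit emitted by a vertex that receives the bits \<open>bs\<close> while the circuit reads the word \<open>x\<close>. The
  number of received bits is left open so that all gates can be treated at once.\<close>

fun gate_value :: "bool list \<Rightarrow> vertex_label \<Rightarrow> bool list \<Rightarrow> bool" where
  "gate_value x (Input i) bs = x ! i"
| "gate_value x NotGate bs = (\<forall>b\<in>set bs. \<not> b)"
| "gate_value x OrGate bs = (\<exists>b\<in>set bs. b)"
| "gate_value x _ bs = (\<forall>b\<in>set bs. b)"

text \<open>A list of boolean functions describes what parallel wires carry, as functions of the \<open>m\<close> input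
  bits. Only adjacent wires are exchanged, because adjacent exchanges suffice for all permutations and
  keep the translation into circuits simple.\<close>

inductive realizable :: "nat \<Rightarrow> (bool list \<Rightarrow> bool) list \<Rightarrow> bool" for m where
  inputs: "realizable m (map (\<lambda>i x. x ! i) [0..<m])"
| gate: "realizable m (hs @ fs) \<Longrightarrow> l \<in> {NotGate, AndGate, OrGate, ForkGate}
    \<Longrightarrow> length hs = in_arity l
    \<Longrightarrow> realizable m (replicate (out_arity l) (\<lambda>x. gate_value x l (map (\<lambda>h. h x) hs)) @ fs)"
| exchange: "realizable m (fs @ f # g # gs) \<Longrightarrow> realizable m (fs @ g # f # gs)"

text \<open>Selection sort: the wire needed next is moved to the front, past those not yet placed.\<close>

lemma realizable_permute:
  assumes "realizable m fs" "mset fs = mset gs"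
  shows "realizable m gs"
proof -
  have front: "realizable m (ps @ g # as @ bs)" if "realizable m (ps @ as @ g # bs)" for ps as bs g
    using that
  proof (induction as arbitrary: bs rule: rev_induct)
    case (snoc a as)
    have "realizable m (ps @ as @ g # a # bs)"
      using realizable.exchange[of m "ps @ as" a g bs] snoc.prems by simp
    from snoc.IH[OF this] show ?case by simp
  qed simp
  have "realizable m (ps @ gs)" if "realizable m (ps @ fs)" "mset fs = mset gs" for ps
    using that
  proof (induction gs arbitrary: ps fs)
    case (Cons g gs)
    then have "g \<in> set fs" by (metis list.set_intros(1) set_mset_mset)
    then obtain as bs where fs: "fs = as @ g # bs" by (auto simp: in_set_conv_decomp)
    have "realizable m ((ps @ [g]) @ as @ bs)"
      using front[of ps as g bs] Cons.prems(1) by (simp add: fs)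
    moreover have "mset (as @ bs) = mset gs" using Cons.prems(2) by (simp add: fs)
    ultimately have "realizable m ((ps @ [g]) @ gs)" by (rule Cons.IH)
    then show ?case by simp
  qed simp
  from this[of "[]"] assms show ?thesis by simp
qed

lemma realizable_not: "realizable m (f # fs) \<Longrightarrow> realizable m ((\<lambda>x. \<not> f x) # fs)"
  using gate[of m "[f]" fs NotGate] by simp

lemma realizable_and: "realizable m (f # g # fs) \<Longrightarrow> realizable m ((\<lambda>x. f x \<and> g x) # fs)"
  using gate[of m "[f, g]" fs AndGate] by simp

lemma realizable_or: "realizable m (f # g # fs) \<Longrightarrow> realizable m ((\<lambda>x. f x \<or> g x) # fs)"
  using gate[of m "[f, g]" fs OrGate] by simp

lemma realizable_fork: "realizable m (f # fs) \<Longrightarrow> realizable m (f # f # fs)"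
  using gate[of m "[f]" fs ForkGate] by (simp add: numeral_2_eq_2)

lemma realizable_copy:
  assumes "realizable m fs" "f \<in> set fs"
  shows "realizable m (f # fs)"
proof -
  obtain as bs where fs: "fs = as @ f # bs" using assms(2) by (auto simp: in_set_conv_decomp)
  have "realizable m (f # as @ bs)" by (rule realizable_permute[OF assms(1)]) (simp add: fs)
  then have "realizable m (f # f # as @ bs)" by (rule realizable_fork)
  then show ?thesis by (rule realizable_permute) (simp add: fs)
qed

text \<open>Circuits have no gate that discards a wire. The surplus function \<open>f\<close> is turned into the constant
  \<open>\<not> f \<and> f\<close>, which the disjunction with \<open>h\<close> absorbs. This needs another wire \<open>h\<close>, which is why
  \<open>n > 0\<close> is required of the functions to be realized.\<close>

lemma realizable_erase:
  assumes "realizable m (f # h # fs)"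
  shows "realizable m (h # fs)"
proof -
  have "realizable m ((\<lambda>x. \<not> f x) # f # h # fs)"
    using assms by (intro realizable_not realizable_fork)
  then have "realizable m ((\<lambda>x. (\<not> f x \<and> f x) \<or> h x) # fs)"
    by (intro realizable_or realizable_and)
  then show ?thesis by simp
qed

inductive_set boolean_closure :: "('a \<Rightarrow> bool) set \<Rightarrow> ('a \<Rightarrow> bool) set" for V where
  var: "f \<in> V \<Longrightarrow> f \<in> boolean_closure V"
| neg: "f \<in> boolean_closure V \<Longrightarrow> (\<lambda>x. \<not> f x) \<in> boolean_closure V"
| conj: "f \<in> boolean_closure V \<Longrightarrow> g \<in> boolean_closure V \<Longrightarrow> (\<lambda>x. f x \<and> g x) \<in> boolean_closure V"

lemma boolean_closure_disj:
  assumes "f \<in> boolean_closure V" "g \<in> boolean_closure V"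
  shows "(\<lambda>x. f x \<or> g x) \<in> boolean_closure V"
proof -
  have "(\<lambda>x. \<not> (\<not> f x \<and> \<not> g x)) \<in> boolean_closure V"
    by (intro boolean_closure.neg boolean_closure.conj assms)
  then show ?thesis by simp
qed

text \<open>The operands of a connective are first added as further wires, so that the wires in \<open>fs\<close>
  survive the gate.\<close>

lemma realizable_add_closure:
  assumes "f \<in> boolean_closure V" "V \<subseteq> set fs" "realizable m fs"
  shows "realizable m (f # fs)"
  using assms
proof (induction arbitrary: fs)
  case (var f)
  then show ?case by (auto intro: realizable_copy)
next
  case (neg f)
  then show ?case by (auto intro: realizable_not)
next
  case (conj f g)
  have "realizable m (g # fs)" using conj by simp
  then have "realizable m (f # g # fs)" using conj.prems by (intro conj.IH(1)) auto
  then show ?case by (rule realizable_and)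
qed

text \<open>Shannon expansion: a function of the first \<open>k + 1\<close> bits is a choice, controlled by bit \<open>k\<close>,
  between two functions of the first \<open>k\<close> bits. A constant is built from some variable, hence
  \<open>0 < m\<close>. Words of other lengths than \<open>m\<close> are left out because their missing bits are arbitrary.\<close>

lemma boolean_closure_complete:
  assumes "0 < m" "k \<le> m"
  shows "\<exists>c \<in> boolean_closure ((\<lambda>i x. x ! i) ` {..<m}). \<forall>x. length x = m \<longrightarrow> c x = h (take k x)"
  using assms(2)
proof (induction k arbitrary: h)
  case 0
  let ?C = "boolean_closure ((\<lambda>i x. x ! i) ` {..<m}) :: (bool list \<Rightarrow> bool) set"
  have v: "(\<lambda>x. x ! 0) \<in> ?C" using assms(1) by (auto intro: boolean_closure.var)
  have "(\<lambda>x. x ! 0 \<and> \<not> x ! 0) \<in> ?C" "(\<lambda>x. x ! 0 \<or> \<not> x ! 0) \<in> ?C"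
    by (intro boolean_closure.conj boolean_closure.neg boolean_closure_disj v)+
  then have "(\<lambda>x. h []) \<in> ?C" by (cases "h []") simp_all
  then show ?case by force
next
  case (Suc k)
  let ?C = "boolean_closure ((\<lambda>i x. x ! i) ` {..<m}) :: (bool list \<Rightarrow> bool) set"
  have v: "(\<lambda>x. x ! k) \<in> ?C" using Suc.prems by (auto intro: boolean_closure.var)
  obtain c d where c: "c \<in> ?C" "\<And>x. length x = m \<Longrightarrow> c x = h (take k x @ [True])"
    and d: "d \<in> ?C" "\<And>x. length x = m \<Longrightarrow> d x = h (take k x @ [False])"
    using Suc.IH[of "\<lambda>y. h (y @ [True])"] Suc.IH[of "\<lambda>y. h (y @ [False])"] Suc.prems
    by (auto simp: Bex_def)
  show ?case
  proof (rule bexI)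
    show "(\<lambda>x. (x ! k \<and> c x) \<or> (\<not> x ! k \<and> d x)) \<in> ?C"
      by (intro boolean_closure.conj boolean_closure.neg boolean_closure_disj v c(1) d(1))
    show "\<forall>x. length x = m \<longrightarrow> ((x ! k \<and> c x) \<or> (\<not> x ! k \<and> d x)) = h (take (Suc k) x)"
    proof (intro allI impI)
      fix x :: "bool list" assume x: "length x = m"
      then have "take (Suc k) x = take k x @ [x ! k]"
        using Suc.prems by (simp add: take_Suc_conv_app_nth)
      then show "((x ! k \<and> c x) \<or> (\<not> x ! k \<and> d x)) = h (take (Suc k) x)"
        using c(2)[OF x] d(2)[OF x] by (cases "x ! k") simp_all
    qed
  qed
qed

text \<open>The components of \<open>F\<close> are added in front of the projections, and then the projections are
  erased.\<close>

lemma realizable_universal: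
  assumes "word_map m n F" "0 < m" "0 < n"
  obtains fs where "realizable m fs" "length fs = n"
    "\<And>x. length x = m \<Longrightarrow> map (\<lambda>f. f x) fs = F x"
proof -
  let ?V = "map (\<lambda>i x. x ! i) [0..<m] :: (bool list \<Rightarrow> bool) list"
  let ?C = "boolean_closure (set ?V)"
  have "\<exists>c. c \<in> ?C \<and> (\<forall>x. length x = m \<longrightarrow> c x = F x ! j)" for j
    using boolean_closure_complete[OF assms(2) order_refl, of "\<lambda>x. F x ! j"]
    by (auto simp: atLeast0LessThan)
  then obtain c where c: "\<And>j. c j \<in> ?C" "\<And>j x. length x = m \<Longrightarrow> c j x = F x ! j"
    by metis
  define fs where "fs = map c [0..<n]"
  have add: "realizable m (gs @ ?V)" if "set gs \<subseteq> ?C" for gs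
    using that
  proof (induction gs)
    case Nil
    show ?case using realizable.inputs by simp
  next
    case (Cons g gs)
    have "realizable m (g # gs @ ?V)"
      by (rule realizable_add_closure[of g "set ?V"]) (use Cons in auto)
    then show ?case by simp
  qed
  have b: "realizable m (fs @ ?V)"
  proof (rule add)
    show "set fs \<subseteq> ?C" using c(1) unfolding fs_def set_map by blast
  qed
  have "realizable m fs" if "realizable m (fs @ us)" for us
    using that
  proof (induction us)
    case (Cons u us)
    obtain h hs where h: "fs = h # hs" using assms(3) by (cases fs) (auto simp: fs_def)
    have "realizable m (u # h # hs @ us)"
      by (rule realizable_permute[OF Cons.prems]) (simp add: h)
    then have "realizable m (h # hs @ us)" by (rule realizable_erase)
    then show ?case using Cons.IH by (simp add: h)
  qed simp
  then have "realizable m fs" using b by blast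
  moreover have "map (\<lambda>f. f x) fs = F x" if "length x = m" for x
  proof (rule nth_equalityI)
    show "length (map (\<lambda>f. f x) fs) = length (F x)"
      using assms(1) that by (simp add: fs_def word_map_def)
    show "map (\<lambda>f. f x) fs ! i = F x ! i" if "i < length (map (\<lambda>f. f x) fs)" for i
      using that c(2)[OF \<open>length x = m\<close>, of i] by (simp add: fs_def)
  qed
  ultimately show thesis using that by (simp add: fs_def)
qed

section \<open>Realizable functions are generated\<close>

definition tuple_map :: "('a \<Rightarrow> 'b) list \<Rightarrow> 'a \<Rightarrow> 'b list" where
  "tuple_map fs x = map (\<lambda>f. f x) fs"

lemma generated_then:
  assumes "extend_to_morphism m F \<in> generated_monoid A" "g \<in> A"
    and "\<And>x u. length x = m \<Longrightarrow> g (F x @ u) = Some (G x @ u)"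
  shows "extend_to_morphism m G \<in> generated_monoid A"
proof -
  have "g \<circ>\<^sub>m extend_to_morphism m F = extend_to_morphism m G"
    using assms(3) by (auto simp: extend_to_morphism_def fun_eq_iff)
  then show ?thesis using assms(1,2) generated_monoid.comp generated_monoid.gen by metis
qed

text \<open>The unit of the monoid is the identity with domain code \<open>{0,1}\<^sup>0\<close>. Its restriction to words of
  length at least \<open>m\<close> is a different element, which is obtained as the square of an involution
  with domain code \<open>{0,1}\<^sup>m\<close>.\<close>

lemma identity_generated:
  assumes "0 < m"
  shows "extend_to_morphism m (\<lambda>x. x)
    \<in> generated_monoid ({not_gate, and_gate, or_gate, fork_gate} \<union> transpositions)"
    (is "_ \<in> generated_monoid ?A")
proof (cases "m = 1")
  case True
  have "not_gate \<circ>\<^sub>m not_gate = extend_to_morphism m (\<lambda>x. x)"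
  proof
    fix z show "(not_gate \<circ>\<^sub>m not_gate) z = extend_to_morphism m (\<lambda>x. x) z"
      by (cases z) (auto simp: True extend_to_morphism_def)
  qed
  moreover have "not_gate \<circ>\<^sub>m not_gate \<in> generated_monoid ?A"
    by (intro generated_monoid.comp generated_monoid.gen) simp_all
  ultimately show ?thesis by simp
next
  case False
  then have m: "1 < m" using assms by simp
  have "transposition 1 m \<circ>\<^sub>m transposition 1 m = extend_to_morphism m (\<lambda>x. x)"
  proof
    fix z :: "bool list"
    have "z[0 := z ! k, k := z ! 0, 0 := z[0 := z ! k, k := z ! 0] ! k,
        k := z[0 := z ! k, k := z ! 0] ! 0] = z" if "k < length z" for k
    proof (rule nth_equalityI)
      have "0 < length z" using that by auto
      with that show "z[0 := z ! k, k := z ! 0, 0 := z[0 := z ! k, k := z ! 0] ! k,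
        k := z[0 := z ! k, k := z ! 0] ! 0] ! i = z ! i"
        if "i < length (z[0 := z ! k, k := z ! 0, 0 := z[0 := z ! k, k := z ! 0] ! k,
          k := z[0 := z ! k, k := z ! 0] ! 0])" for i
        by (simp add: nth_list_update)
    qed simp
    from this[of "m - 1"] m
    show "(transposition 1 m \<circ>\<^sub>m transposition 1 m) z = extend_to_morphism m (\<lambda>x. x) z"
      by (simp add: transposition_def extend_to_morphism_def)
  qed
  moreover have "transposition 1 m \<in> ?A" using m by (auto simp: transpositions_def)
  ultimately show ?thesis using generated_monoid.comp generated_monoid.gen by metis
qed

lemma realizable_generated:
  assumes "realizable m fs" "0 < m"
  shows "extend_to_morphism m (tuple_map fs)
    \<in> generated_monoid ({not_gate, and_gate, or_gate, fork_gate} \<union> transpositions)"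
    (is "_ \<in> generated_monoid ?A")
  using assms(1)
proof induction
  case inputs
  have "tuple_map (map (\<lambda>i x. x ! i) [0..<m]) x = x" if "length x = m" for x :: "bool list"
    using map_nth[of x] that by (simp add: tuple_map_def comp_def)
  then show ?case
    using identity_generated[OF assms(2)] extend_to_morphism_cong by (metis (no_types, lifting))
next
  case (gate hs fs l)
  from gate.hyps(2) consider "l = NotGate" | "l = AndGate" | "l = OrGate" | "l = ForkGate" by auto
  then show ?case
  proof cases
    case 1
    then obtain h where "hs = [h]" using gate.hyps(3) by (auto simp: length_Suc_conv)
    with 1 show ?thesis
      by (intro generated_then[OF gate.IH, of not_gate]) (auto simp: tuple_map_def)
  next
    case 2
    then obtain h h' where "hs = [h, h']"
      using gate.hyps(3) by (auto simp: length_Suc_conv numeral_2_eq_2)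
    with 2 show ?thesis
      by (intro generated_then[OF gate.IH, of and_gate]) (auto simp: tuple_map_def)
  next
    case 3
    then obtain h h' where "hs = [h, h']"
      using gate.hyps(3) by (auto simp: length_Suc_conv numeral_2_eq_2)
    with 3 show ?thesis
      by (intro generated_then[OF gate.IH, of or_gate]) (auto simp: tuple_map_def)
  next
    case 4
    then obtain h where "hs = [h]" using gate.hyps(3) by (auto simp: length_Suc_conv)
    with 4 show ?thesis
      by (intro generated_then[OF gate.IH, of fork_gate])
        (auto simp: tuple_map_def numeral_2_eq_2)
  qed
next
  case (exchange fs f g gs)
  show ?case
  proof (rule generated_then[OF exchange.IH])
    show "transposition (Suc (length fs)) (Suc (Suc (length fs))) \<in> ?A"
      by (auto simp: transpositions_def)
    show "transposition (Suc (length fs)) (Suc (Suc (length fs)))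
        (tuple_map (fs @ f # g # gs) x @ u) = Some (tuple_map (fs @ g # f # gs) x @ u)" for x u
      by (simp add: transposition_def tuple_map_def nth_append list_update_append)
  qed
qed

lemma balanced_generated:
  assumes "word_map m n F" "m = 0 \<longleftrightarrow> n = 0"
  shows "extend_to_morphism m F
    \<in> generated_monoid ({not_gate, and_gate, or_gate, fork_gate} \<union> transpositions)"
proof (cases "m = 0")
  case True
  then have "extend_to_morphism m F = Some"
    using assms by (auto simp: extend_to_morphism_def word_map_def fun_eq_iff)
  then show ?thesis using generated_monoid.unit by simp
next
  case False
  then obtain fs where fs: "realizable m fs" "\<And>x. length x = m \<Longrightarrow> map (\<lambda>f. f x) fs = F x"
    using realizable_universal[OF assms(1)] assms(2) by (metis not_gr_zero)
  have "extend_to_morphism m F = extend_to_morphism m (tuple_map fs)"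
    by (rule extend_to_morphism_cong) (simp add: tuple_map_def fs(2))
  then show ?thesis using realizable_generated[OF fs(1)] False by simp
qed

lemma balanced_monoid_generated:
  "generated_monoid ({not_gate, and_gate, or_gate, fork_gate} \<union> transpositions)
    = {f \<in> tflRM. domC f = {[]} \<longleftrightarrow> imC f = {[]}}"
proof
  show "generated_monoid ({not_gate, and_gate, or_gate, fork_gate} \<union> transpositions)
      \<subseteq> {f \<in> tflRM. domC f = {[]} \<longleftrightarrow> imC f = {[]}}"
    by (rule generated_monoid_least[OF unit_balanced generators_balanced balanced_comp])
  show "{f \<in> tflRM. domC f = {[]} \<longleftrightarrow> imC f = {[]}}
      \<subseteq> generated_monoid ({not_gate, and_gate, or_gate, fork_gate} \<union> transpositions)"
    by (intro subsetI, erule balancedE) (simp only: balanced_generated)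
qed

section \<open>A finite set that generates everything together with the transpositions\<close>

abbreviation const_false :: "bool list \<rightharpoonup> bool list" where
  "const_false \<equiv> \<lambda>v. Some (False # v)"

abbreviation erase_bit :: "bool list \<rightharpoonup> bool list" where
  "erase_bit \<equiv> \<lambda>z. if z = [] then None else Some (tl z)"

lemma generated_monoid_mono:
  assumes "A \<subseteq> B"
  shows "generated_monoid A \<subseteq> generated_monoid B"
  using assms by (intro generated_monoid_least) (auto intro: generated_monoid.intros)

text \<open>The elements not reached by the gates and transpositions have \<open>m = 0\<close> or \<open>n = 0\<close>. The former
  prepend a fixed word, which is written bit by bit; the latter delete the first \<open>m\<close> bits.\<close>

lemma tflRM_finitely_generated:
  "generated_monoid ({not_gate, and_gate, or_gate, fork_gate, const_false, erase_bit}
      \<union> transpositions) = tflRM"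
    (is "generated_monoid ?A = _")
proof
  show "generated_monoid ?A \<subseteq> tflRM"
  proof (rule generated_monoid_least[OF _ _ tflRM_comp])
    show "Some \<in> tflRM" using unit_balanced by simp
    have "{not_gate, and_gate, or_gate, fork_gate} \<union> transpositions \<subseteq> tflRM"
      using generators_balanced by (rule subset_trans) (rule Collect_subset)
    then show "?A \<subseteq> tflRM"
      using constant_boundary(1) erasure_boundary(1)
      by (simp only: insert_subset Un_subset_iff empty_subsetI simp_thms)
  qed
  have "({not_gate, and_gate, or_gate, fork_gate} \<union> transpositions) \<subseteq> ?A" by auto
  note gates = subsetD[OF generated_monoid_mono[OF this]]
  show "tflRM \<subseteq> generated_monoid ?A"
  proof
    fix f assume "f \<in> tflRM"
    then obtain m n F where F: "word_map m n F" "f = extend_to_morphism m F"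
      unfolding tflRM_iff by blast
    consider "m = 0" | "n = 0" | "m = 0 \<longleftrightarrow> n = 0" by blast
    then show "f \<in> generated_monoid ?A"
    proof cases
      case 1
      have "extend_to_morphism 0 (\<lambda>x. w) \<in> generated_monoid ?A" for w
      proof (induction w)
        case Nil
        have "extend_to_morphism 0 (\<lambda>x. []) = Some"
          by (simp add: extend_to_morphism_def fun_eq_iff)
        then show ?case using generated_monoid.unit by simp
      next
        case (Cons b w)
        have F: "extend_to_morphism 0 (\<lambda>x. False # w) \<in> generated_monoid ?A"
          by (rule generated_then[OF Cons, of const_false]) simp_all
        have "extend_to_morphism 0 (\<lambda>x. True # w) \<in> generated_monoid ?A"
          by (rule generated_then[OF F, of not_gate]) simp_all
        with F show ?case by (cases b) simp_all
      qed
      moreover have "f = extend_to_morphism 0 (\<lambda>x. F [])"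
        unfolding F(2) 1 by (rule extend_to_morphism_cong) simp
      ultimately show ?thesis by simp
    next
      case 2
      have "extend_to_morphism k (\<lambda>x. []) \<in> generated_monoid ?A" for k
      proof (induction k)
        case 0
        have "extend_to_morphism 0 (\<lambda>x. []) = Some"
          by (simp add: extend_to_morphism_def fun_eq_iff)
        then show ?case using generated_monoid.unit by simp
      next
        case (Suc k)
        have step: "erase_bit \<circ>\<^sub>m extend_to_morphism k (\<lambda>x. []) = extend_to_morphism (Suc k) (\<lambda>x. [])"
        proof
          fix z :: "bool list"
          consider "length z < k" | "length z = k" | "k < length z" by linarith
          then show "(erase_bit \<circ>\<^sub>m extend_to_morphism k (\<lambda>x. [])) z
              = extend_to_morphism (Suc k) (\<lambda>x. []) z"
            by cases (simp_all add: extend_to_morphism_def tl_drop drop_Suc)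
        qed
        have "erase_bit \<in> generated_monoid ?A"
          by (rule generated_monoid.gen) simp
        from generated_monoid.comp[OF this Suc] show ?case unfolding step .
      qed
      moreover have "f = extend_to_morphism m (\<lambda>x. [])"
        using F(1) unfolding F(2) 2 word_map_def by (intro extend_to_morphism_cong) simp
      ultimately show ?thesis by simp
    next
      case 3
      then show ?thesis using balanced_generated[OF F(1)] gates F(2) by blast
    qed
  qed
qed

section \<open>Circuits from lists of gates\<close>

text \<open>A list entry gives the label of a vertex and the tails of its incoming arcs. Each vertex has
  at most two incoming arcs, so arc \<open>k\<close> into vertex \<open>v\<close> can be numbered \<open>2 * v + k\<close>.\<close>

definition netlist_graph :: "(vertex_label \<times> nat list) list \<Rightarrow> (nat, nat) pre_digraph" where
  "netlist_graph vs = \<lparr>verts = {..<length vs},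
     arcs = {a. a div 2 < length vs \<and> a mod 2 < length (snd (vs ! (a div 2)))},
     tail = (\<lambda>a. snd (vs ! (a div 2)) ! (a mod 2)),
     head = (\<lambda>a. a div 2)\<rparr>"

text \<open>Vertices refer only to earlier ones, which makes the digraph acyclic.\<close>

definition netlist :: "(vertex_label \<times> nat list) list \<Rightarrow> bool" where
  "netlist vs \<longleftrightarrow> (\<forall>v<length vs. length (snd (vs ! v)) = in_arity (fst (vs ! v))
     \<and> (\<forall>p\<in>set (snd (vs ! v)). p < v))"

lemma in_arity_le_2: "in_arity l \<le> 2"
  by (cases l) auto

lemma arc_number:
  fixes k v :: nat
  assumes "k < 2"
  shows "(2 * v + k) div 2 = v" "(2 * v + k) mod 2 = k"
  using assms by simp_all

lemma in_arcs_netlist_graph: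
  assumes "netlist vs" "v < length vs"
  shows "in_arcs (netlist_graph vs) v = (\<lambda>k. 2 * v + k) ` {..<length (snd (vs ! v))}"
proof (intro equalityI subsetI)
  fix a assume "a \<in> in_arcs (netlist_graph vs) v"
  then have "a div 2 = v" "a mod 2 < length (snd (vs ! v))"
    by (auto simp: in_arcs_def netlist_graph_def)
  then show "a \<in> (\<lambda>k. 2 * v + k) ` {..<length (snd (vs ! v))}"
    by (metis image_eqI lessThan_iff mult_div_mod_eq)
next
  fix a assume "a \<in> (\<lambda>k. 2 * v + k) ` {..<length (snd (vs ! v))}"
  then obtain k where k: "k < length (snd (vs ! v))" "a = 2 * v + k" by auto
  have "k < 2"
    using k(1) assms in_arity_le_2[of "fst (vs ! v)"] by (auto simp: netlist_def)
  then show "a \<in> in_arcs (netlist_graph vs) v"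
    using arc_number[of k v] k assms by (simp add: in_arcs_def netlist_graph_def)
qed

lemma tails_netlist_graph:
  assumes "netlist vs" "v < length vs"
  shows "tail (netlist_graph vs) ` in_arcs (netlist_graph vs) v = set (snd (vs ! v))"
proof -
  have "tail (netlist_graph vs) (2 * v + k) = snd (vs ! v) ! k" if "k < length (snd (vs ! v))" for k
  proof -
    have "k < 2"
      using that assms in_arity_le_2[of "fst (vs ! v)"] by (auto simp: netlist_def)
    then show ?thesis using arc_number[of k v] by (simp add: netlist_graph_def)
  qed
  then show ?thesis
    unfolding in_arcs_netlist_graph[OF assms] by (auto simp: in_set_conv_nth image_iff)
qed

lemma in_degree_netlist_graph:
  assumes "netlist vs" "v < length vs"
  shows "in_degree (netlist_graph vs) v = in_arity (fst (vs ! v))"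
  using assms unfolding in_degree_def in_arcs_netlist_graph[OF assms]
  by (simp add: card_image netlist_def)

lemma count_list_concat: "count_list (concat xss) u = (\<Sum>v<length xss. count_list (xss ! v) u)"
proof -
  have "count_list (concat xss) u = (\<Sum>xs\<leftarrow>xss. count_list xs u)" by (induction xss) auto
  then show ?thesis by (simp add: sum_list_sum_nth atLeast0LessThan)
qed

text \<open>The arcs leaving \<open>u\<close> are grouped by the vertex that they enter.\<close>

lemma out_degree_netlist_graph:
  assumes "netlist vs"
  shows "out_degree (netlist_graph vs) u = count_list (concat (map snd vs)) u"
proof -
  let ?K = "\<lambda>v. {k. k < length (snd (vs ! v)) \<and> u = snd (vs ! v) ! k}"
  have k2: "k < 2" if "k < length (snd (vs ! v))" "v < length vs" for v k
    using that assms in_arity_le_2[of "fst (vs ! v)"] by (auto simp: netlist_def)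
  have "out_arcs (netlist_graph vs) u = (\<Union>v<length vs. (\<lambda>k. 2 * v + k) ` ?K v)"
  proof (intro equalityI subsetI)
    fix a assume "a \<in> out_arcs (netlist_graph vs) u"
    then have "a div 2 < length vs" "a mod 2 \<in> ?K (a div 2)"
      by (auto simp: out_arcs_def netlist_graph_def)
    moreover have "a = 2 * (a div 2) + a mod 2" by simp
    ultimately show "a \<in> (\<Union>v<length vs. (\<lambda>k. 2 * v + k) ` ?K v)" by blast
  next
    fix a assume "a \<in> (\<Union>v<length vs. (\<lambda>k. 2 * v + k) ` ?K v)"
    then obtain v k where vk: "v < length vs" "k \<in> ?K v" "a = 2 * v + k" by auto
    then have "k < 2" using k2 by auto
    then show "a \<in> out_arcs (netlist_graph vs) u"
      using arc_number[of k v] vk by (simp add: out_arcs_def netlist_graph_def)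
  qed
  moreover have "(\<lambda>k. 2 * v + k) ` ?K v \<inter> (\<lambda>k. 2 * w + k) ` ?K w = {}"
    if "v < length vs" "w < length vs" "v \<noteq> w" for v w
  proof -
    have "v = w" if a: "a = 2 * v + k" "a = 2 * w + k'" "k < length (snd (vs ! v))"
      "k' < length (snd (vs ! w))" for a k k'
      using k2[OF a(3) \<open>v < length vs\<close>] k2[OF a(4) \<open>w < length vs\<close>] a(1,2) by linarith
    with \<open>v \<noteq> w\<close> show ?thesis by blast
  qed
  ultimately have "out_degree (netlist_graph vs) u = (\<Sum>v<length vs. card ((\<lambda>k. 2 * v + k) ` ?K v))"
    unfolding out_degree_def by (subst card_UN_disjoint[symmetric]) auto
  also have "\<dots> = (\<Sum>v<length vs. count_list (snd (vs ! v)) u)"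
    by (intro sum.cong refl)
      (simp add: card_image count_list_eq_length_filter length_filter_conv_card)
  also have "\<dots> = count_list (concat (map snd vs)) u"
    by (simp add: count_list_concat)
  finally show ?thesis .
qed

lemma netlist_graph_acyclic:
  assumes "netlist vs"
  shows "fin_digraph (netlist_graph vs)" "acyclic (arcs_ends (netlist_graph vs))"
proof -
  have lt: "tail (netlist_graph vs) a < head (netlist_graph vs) a"
    if "a \<in> arcs (netlist_graph vs)" for a
    using that assms by (auto simp: netlist_graph_def netlist_def)
  have "arcs (netlist_graph vs) \<subseteq> {..<2 * length vs}"
    by (auto simp: netlist_graph_def)
  then have fin: "finite (arcs (netlist_graph vs))" using finite_subset by blast
  show "fin_digraph (netlist_graph vs)"
  proof
    fix a assume a: "a \<in> arcs (netlist_graph vs)"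
    then show h: "head (netlist_graph vs) a \<in> verts (netlist_graph vs)"
      by (simp add: netlist_graph_def)
    show "tail (netlist_graph vs) a \<in> verts (netlist_graph vs)"
      using lt[OF a] h by (simp add: netlist_graph_def)
  qed (use fin in \<open>auto simp: netlist_graph_def\<close>)
  have "arcs_ends (netlist_graph vs) \<subseteq> less_than"
    using lt by (auto simp: arcs_ends_def arc_to_ends_def)
  then show "acyclic (arcs_ends (netlist_graph vs))"
    using acyclic_subset wf_acyclic wf_less_than by blast
qed

lemma valuation_netlist_graph:
  assumes "netlist vs"
  shows "valuation (netlist_graph vs) (\<lambda>v. fst (vs ! v)) x val \<longleftrightarrow>
    (\<forall>v<length vs. val v = gate_value x (fst (vs ! v)) (map val (snd (vs ! v))))"
proof -
  have "vertex_rule (netlist_graph vs) val x v (fst (vs ! v))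
      = gate_value x (fst (vs ! v)) (map val (snd (vs ! v)))" if "v < length vs" for v
  proof -
    have all: "(\<forall>a\<in>in_arcs (netlist_graph vs) v. P (tail (netlist_graph vs) a))
        \<longleftrightarrow> (\<forall>p\<in>set (snd (vs ! v)). P p)" for P
      unfolding tails_netlist_graph[OF assms that, symmetric] by simp
    have ex: "(\<exists>a\<in>in_arcs (netlist_graph vs) v. P (tail (netlist_graph vs) a))
        \<longleftrightarrow> (\<exists>p\<in>set (snd (vs ! v)). P p)" for P
      unfolding tails_netlist_graph[OF assms that, symmetric] by simp
    show ?thesis
      by (cases "fst (vs ! v)") (simp_all add: all ex all[where P = "\<lambda>p. \<not> val p"])
  qed
  then show ?thesis
    by (auto simp: valuation_def netlist_graph_def)
qed

definition input_list :: "nat \<Rightarrow> (vertex_label \<times> nat list) list" where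
  "input_list m = map (\<lambda>i. (Input i, [])) [0..<m]"

text \<open>A circuit under construction, without output vertices. Its vertices are the inputs followed by the
  gates \<open>gs\<close>; \<open>ts\<close> lists the vertices from which the open wires start, and \<open>fs\<close> what these wires
  carry. The condition on \<open>count_list\<close> says that the open wires are exactly the outgoing arcs that the
  arities still demand.\<close>

definition open_circuit ::
    "nat \<Rightarrow> (vertex_label \<times> nat list) list \<Rightarrow> nat list \<Rightarrow> (bool list \<Rightarrow> bool) list \<Rightarrow> bool" where
  "open_circuit m gs ts fs \<longleftrightarrow>
     (let vs = input_list m @ gs in
       fst ` set gs \<subseteq> {NotGate, AndGate, OrGate, ForkGate} \<and> netlist vs
       \<and> (\<forall>t\<in>set ts. t < length vs)
       \<and> (\<forall>u<length vs. count_list (concat (map snd vs)) u + count_list ts u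
            = out_arity (fst (vs ! u)))
       \<and> length ts = length fs
       \<and> (\<forall>x. \<exists>val. (\<forall>v<length vs. val v = gate_value x (fst (vs ! v)) (map val (snd (vs ! v))))
            \<and> map val ts = map (\<lambda>f. f x) fs))"

lemma netlist_append1:
  assumes "netlist vs" "length ps = in_arity l" "\<forall>p\<in>set ps. p < length vs"
  shows "netlist (vs @ [(l, ps)])"
  using assms by (auto simp: netlist_def nth_append less_Suc_eq)

lemma count_list_fresh: "\<forall>t\<in>set ts. t < (N :: nat) \<Longrightarrow> count_list ts N = 0"
  by (auto simp: count_list_0_iff)

lemma netlist_wires:
  assumes "netlist vs" "p \<in> set (concat (map snd vs))"
  shows "p < length vs"
proof -
  obtain v where "v < length vs" "p \<in> set (snd (vs ! v))"
    using assms(2) by (auto simp: in_set_conv_nth[of _ vs])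
  then show ?thesis using assms(1) by (auto simp: netlist_def dest: less_trans)
qed

lemma count_list_replicate: "count_list (replicate k y) u = (if y = u then k else 0)"
  by (induction k) auto

text \<open>The new gate becomes the last vertex, with the number \<open>m + length gs\<close>. It consumes the first open
  wires and opens as many new ones as its out-arity demands, so the balance of arcs is preserved.\<close>

lemma open_circuit_gate:
  assumes oc: "open_circuit m gs (ps @ ts) (hs @ fs)"
    and l: "l \<in> {NotGate, AndGate, OrGate, ForkGate}"
    and len: "length hs = in_arity l" "length ps = length hs"
  shows "open_circuit m (gs @ [(l, ps)]) (replicate (out_arity l) (m + length gs) @ ts)
    (replicate (out_arity l) (\<lambda>x. gate_value x l (map (\<lambda>h. h x) hs)) @ fs)"
proof -
  define vs where "vs = input_list m @ gs"
  have N: "length vs = m + length gs" by (simp add: vs_def input_list_def)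
  have gs: "fst ` set gs \<subseteq> {NotGate, AndGate, OrGate, ForkGate}" and nl: "netlist vs"
    and ts: "\<forall>t\<in>set (ps @ ts). t < length vs"
    and cnt: "\<And>u. u < length vs \<Longrightarrow> count_list (concat (map snd vs)) u + count_list (ps @ ts) u
            = out_arity (fst (vs ! u))"
    and lf: "length (ps @ ts) = length (hs @ fs)"
    and ex: "\<And>x. \<exists>val. (\<forall>v<length vs. val v = gate_value x (fst (vs ! v)) (map val (snd (vs ! v))))
            \<and> map val (ps @ ts) = map (\<lambda>f. f x) (hs @ fs)"
    using oc unfolding open_circuit_def vs_def Let_def by blast+
  have preds: "\<forall>p\<in>set (snd (vs ! v)). p < length vs" if "v < length vs" for v
    using nl that by (auto simp: netlist_def dest: less_trans)
  have nl': "netlist (vs @ [(l, ps)])"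
    using nl len ts by (intro netlist_append1) auto
  have cnt': "count_list (concat (map snd (vs @ [(l, ps)]))) u
      + count_list (replicate (out_arity l) (length vs) @ ts) u = out_arity (fst ((vs @ [(l, ps)]) ! u))"
    if "u < length (vs @ [(l, ps)])" for u
  proof (cases "u < length vs")
    case True
    then show ?thesis using cnt[OF True] by (simp add: nth_append count_list_replicate)
  next
    case False
    then have u: "u = length vs" using that by simp
    have "count_list (concat (map snd vs)) u = 0" "count_list ps u = 0" "count_list ts u = 0"
      using ts netlist_wires[OF nl] unfolding u by (intro count_list_fresh; auto)+
    then show ?thesis by (simp add: u count_list_replicate)
  qed
  have ex': "\<exists>val. (\<forall>v<length (vs @ [(l, ps)]). val v = gate_value x (fst ((vs @ [(l, ps)]) ! v))
          (map val (snd ((vs @ [(l, ps)]) ! v))))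
      \<and> map val (replicate (out_arity l) (length vs) @ ts)
        = map (\<lambda>f. f x) (replicate (out_arity l) (\<lambda>x. gate_value x l (map (\<lambda>h. h x) hs)) @ fs)" for x
  proof -
    obtain val where val: "\<And>v. v < length vs \<Longrightarrow> val v = gate_value x (fst (vs ! v)) (map val (snd (vs ! v)))"
      and out: "map val ps = map (\<lambda>h. h x) hs" "map val ts = map (\<lambda>f. f x) fs"
      using ex[of x] len(2) by (auto simp: append_eq_append_conv)
    define val' where "val' = val(length vs := gate_value x l (map (\<lambda>h. h x) hs))"
    have old: "map val' qs = map val qs" if "\<forall>q\<in>set qs. q < length vs" for qs
      using that by (auto simp: val'_def)
    have "val' v = gate_value x (fst ((vs @ [(l, ps)]) ! v)) (map val' (snd ((vs @ [(l, ps)]) ! v)))"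
      if "v < length (vs @ [(l, ps)])" for v
    proof (cases "v < length vs")
      case True
      then have "val' v = val v" by (simp add: val'_def)
      then show ?thesis
        using val[OF True] by (simp only: nth_append True if_True old[OF preds[OF True]])
    next
      case False
      then have v: "v = length vs" using that by simp
      have "map val' ps = map val ps" using ts by (intro old) auto
      then show ?thesis by (simp add: v out(1)) (simp add: val'_def)
    qed
    moreover have "map val' ts = map val ts" using ts by (intro old) auto
    ultimately show ?thesis
      using out(2) by (intro exI[of _ val']) (auto simp: val'_def)
  qed
  show ?thesis
    unfolding open_circuit_def Let_def append_assoc[symmetric] vs_def[symmetric] N[symmetric]
  proof (intro conjI)
    show "fst ` set (gs @ [(l, ps)]) \<subseteq> {NotGate, AndGate, OrGate, ForkGate}"
      using gs l by simp
    show "\<forall>t\<in>set (replicate (out_arity l) (length vs) @ ts). t < length (vs @ [(l, ps)])"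
      using ts by (auto simp: less_Suc_eq)
    show "length (replicate (out_arity l) (length vs) @ ts)
        = length (replicate (out_arity l) (\<lambda>x. gate_value x l (map (\<lambda>h. h x) hs)) @ fs)"
      using lf len(2) by simp
  qed (use nl' cnt' ex' in blast)+
qed

text \<open>Open wires are only a list, so they are exchanged without changing the digraph.\<close>

lemma open_circuit_exchange:
  assumes oc: "open_circuit m gs (as @ t # u # bs) (fs @ f # g # hs)"
    and len: "length as = length fs"
  shows "open_circuit m gs (as @ u # t # bs) (fs @ g # f # hs)"
proof -
  have count: "count_list (as @ u # t # bs) w = count_list (as @ t # u # bs) w" for w by simp
  have set: "set (as @ u # t # bs) = set (as @ t # u # bs)" by auto
  have lists: "length (as @ u # t # bs) = length (fs @ g # f # hs)
      \<longleftrightarrow> length (as @ t # u # bs) = length (fs @ f # g # hs)" by simp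
  have map: "map val (as @ u # t # bs) = map (\<lambda>f. f x) (fs @ g # f # hs)
      \<longleftrightarrow> map val (as @ t # u # bs) = map (\<lambda>f. f x) (fs @ f # g # hs)" for val x
    using len by (auto simp: append_eq_append_conv)
  show ?thesis
    using oc unfolding open_circuit_def Let_def count set lists map .
qed

lemma realizable_open_circuit:
  assumes "realizable m fs"
  shows "\<exists>gs ts. open_circuit m gs ts fs"
  using assms
proof induction
  case inputs
  have "count_list [0..<m] u = 1" if "u < m" for u
    using that by (induction m) auto
  moreover have "map snd (input_list m) = replicate m []"
    by (simp add: input_list_def comp_def map_replicate_const)
  ultimately have "open_circuit m [] [0..<m] (map (\<lambda>i x. x ! i) [0..<m])"
    unfolding open_circuit_def Let_def
    by (auto simp: netlist_def input_list_def intro!: exI[of _ "\<lambda>i. _ ! i"])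
  then show ?case by blast
next
  case (gate hs fs l)
  then obtain gs ts where oc: "open_circuit m gs ts (hs @ fs)" by blast
  then have "length ts = length (hs @ fs)" by (simp add: open_circuit_def Let_def)
  then have "length (take (length hs) ts) = length hs" by simp
  moreover have "open_circuit m gs (take (length hs) ts @ drop (length hs) ts) (hs @ fs)"
    using oc by simp
  ultimately show ?case using open_circuit_gate gate.hyps(2,3) by blast
next
  case (exchange fs f g hs)
  then obtain gs ts where oc: "open_circuit m gs ts (fs @ f # g # hs)" by blast
  then have "length ts = Suc (Suc (length fs + length hs))" by (simp add: open_circuit_def Let_def)
  then have "length (drop (length fs) ts) = Suc (Suc (length hs))" by simp
  then obtain t u bs where "drop (length fs) ts = t # u # bs"
    unfolding length_Suc_conv by blast
  then have "ts = take (length fs) ts @ t # u # bs" by (metis append_take_drop_id)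
  moreover have "length (take (length fs) ts) = length fs" using \<open>length ts = _\<close> by simp
  ultimately show ?case using open_circuit_exchange oc by metis
qed

text \<open>Attaching an output vertex to every open wire supplies all missing outgoing arcs.\<close>

lemma open_circuit_closed:
  assumes oc: "open_circuit m gs ts fs" and n: "n = length fs"
  obtains G lab where "circuit G lab m n" "\<And>x. io_function G lab n x = map (\<lambda>f. f x) fs"
proof -
  define vs where "vs = input_list m @ gs"
  define ws where "ws = vs @ map (\<lambda>j. (Output j, [ts ! j])) [0..<n]"
  let ?G = "netlist_graph ws" and ?lab = "\<lambda>v. fst (ws ! v)"
  have gs: "fst ` set gs \<subseteq> {NotGate, AndGate, OrGate, ForkGate}" and nl: "netlist vs"
    and ts: "\<forall>t\<in>set ts. t < length vs"
    and cnt: "\<And>u. u < length vs \<Longrightarrow> count_list (concat (map snd vs)) u + count_list ts u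
            = out_arity (fst (vs ! u))"
    and lf: "length ts = n"
    and ex: "\<And>x. \<exists>val. (\<forall>v<length vs. val v = gate_value x (fst (vs ! v)) (map val (snd (vs ! v))))
            \<and> map val ts = map (\<lambda>f. f x) fs"
    using oc n unfolding open_circuit_def vs_def Let_def by auto
  define N where "N = length vs"
  have lN: "length vs = N" "length ws = N + n" by (simp_all add: N_def ws_def)
  have old: "ws ! v = vs ! v" if "v < N" for v using that by (simp add: ws_def nth_append N_def)
  have new: "ws ! (N + j) = (Output j, [ts ! j])" if "j < n" for j
    using that by (simp add: ws_def nth_append N_def)
  have cases: "(v < N \<Longrightarrow> P) \<Longrightarrow> (\<And>j. j < n \<Longrightarrow> v = N + j \<Longrightarrow> P) \<Longrightarrow> P" if "v < N + n" for v P
    using that by (metis add_less_cancel_left le_Suc_ex not_le)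
  have tsN: "ts ! j < N" if "j < n" for j using ts lf that by (simp add: N_def)
  have nl': "netlist ws"
    unfolding netlist_def lN
  proof (intro allI impI)
    fix v assume "v < N + n"
    then show "length (snd (ws ! v)) = in_arity (?lab v) \<and> (\<forall>p\<in>set (snd (ws ! v)). p < v)"
      using nl tsN by (elim cases) (auto simp: old new netlist_def lN trans_less_add1)
  qed
  have "concat (map snd ws) = concat (map snd vs) @ map (\<lambda>j. ts ! j) [0..<n]"
    by (simp add: ws_def comp_def concat_map_singleton)
  then have wires: "concat (map snd ws) = concat (map snd vs) @ ts"
    using map_nth[of ts] lf by simp
  have out: "count_list (concat (map snd ws)) u = out_arity (?lab u)" if "u < N + n" for u
    using that
  proof (rule cases)
    assume "u < N" then show ?thesis using cnt[of u] by (simp add: wires old lN)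
  next
    fix j assume j: "j < n" "u = N + j"
    have "t < N" if "t \<in> set (concat (map snd ws))" for t
      using that netlist_wires[OF nl, of t] ts unfolding wires lN by (auto simp del: set_concat)
    then have "count_list (concat (map snd ws)) u = 0"
      unfolding j by (intro count_list_fresh ballI trans_less_add1)
    then show ?thesis by (simp add: j new)
  qed
  have ins: "?lab v = Input v" if "v < m" for v
    using that old[of v] by (simp add: vs_def input_list_def nth_append N_def)
  have mN: "m \<le> N" by (simp add: N_def vs_def input_list_def)
  have inner: "?lab v \<in> {NotGate, AndGate, OrGate, ForkGate}" if "m \<le> v" "v < N" for v
  proof -
    have "ws ! v = gs ! (v - m)" "v - m < length gs"
      using that old[of v] by (auto simp: vs_def input_list_def nth_append N_def)
    then show ?thesis using gs by (metis image_eqI nth_mem subsetD)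
  qed
  have outs: "?lab (N + j) = Output j" if "j < n" for j
    using new[OF that] by simp
  have vertex_cases: P if "v < N + n" "v < m \<Longrightarrow> P" "m \<le> v \<Longrightarrow> v < N \<Longrightarrow> P"
    "\<And>j. j < n \<Longrightarrow> v = N + j \<Longrightarrow> P" for v P
    using that(1)
  proof (rule cases)
    assume "v < N"
    then show P using that(2,3) by (cases "v < m") simp_all
  qed (rule that(4))
  have lab_in: "?lab v = Input i \<longleftrightarrow> v = i \<and> v < m" if "v < N + n" for v i
    using that
  proof (rule vertex_cases)
    assume "v < m" then show ?thesis using ins[of v] mN by auto
  next
    assume v: "m \<le> v" "v < N" then show ?thesis using inner[OF v] by auto
  next
    fix j assume "j < n" "v = N + j" then show ?thesis using outs[of j] mN by auto
  qed
  have lab_out: "?lab v = Output i \<longleftrightarrow> v = N + i" if "v < N + n" for v i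
    using that
  proof (rule vertex_cases)
    assume "v < m" then show ?thesis using ins[of v] mN by auto
  next
    assume v: "m \<le> v" "v < N" then show ?thesis using inner[OF v] by auto
  next
    fix j assume "j < n" "v = N + j" then show ?thesis using outs[of j] mN by auto
  qed
  have verts: "verts ?G = {..<N + n}" by (simp add: netlist_graph_def lN)
  have "{v \<in> verts ?G. \<exists>i. ?lab v = Input i} = {..<m}"
    using mN by (auto simp: verts lab_in)
  then have bij_in: "bij_betw ?lab {v \<in> verts ?G. \<exists>i. ?lab v = Input i} (Input ` {..<m})"
    using ins by (auto simp: bij_betw_def inj_on_def image_iff)
  have "{v \<in> verts ?G. \<exists>j. ?lab v = Output j} = (\<lambda>j. N + j) ` {..<n}"
    by (auto simp: verts lab_out image_iff)
  then have bij_out: "bij_betw ?lab {v \<in> verts ?G. \<exists>j. ?lab v = Output j} (Output ` {..<n})"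
    using outs by (auto simp: bij_betw_def inj_on_def image_iff)
  have circ: "circuit ?G ?lab m n"
    unfolding circuit_def using netlist_graph_acyclic[OF nl'] bij_in bij_out
    by (simp add: verts in_degree_netlist_graph[OF nl'] out_degree_netlist_graph[OF nl'] out lN)
  have "io_function ?G ?lab n x = map (\<lambda>f. f x) fs" for x
    unfolding io_function_def
  proof (rule the1_equality[OF io_function_ex1[OF circ]], intro conjI)
    show "length (map (\<lambda>f. f x) fs) = n" by (simp add: n)
    obtain val where val: "\<And>v. v < N \<Longrightarrow> val v = gate_value x (fst (vs ! v)) (map val (snd (vs ! v)))"
      and vts: "map val ts = map (\<lambda>f. f x) fs"
      using ex[of x] lN by auto
    \<comment> \<open>The output vertex \<open>N + j\<close> takes the bit of the vertex from which wire \<open>j\<close> starts.\<close>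
    define val' where "val' v = (if v < N then val v else val (ts ! (v - N)))" for v
    have keep: "map val' (snd (vs ! v)) = map val (snd (vs ! v))" if "v < N" for v
    proof (rule map_cong[OF refl])
      fix p assume "p \<in> set (snd (vs ! v))"
      then have "p < N" using nl that by (auto simp: netlist_def lN dest: less_trans)
      then show "val' p = val p" by (simp add: val'_def)
    qed
    have "val' v = gate_value x (fst (ws ! v)) (map val' (snd (ws ! v)))" if "v < N + n" for v
      using that
    proof (rule cases)
      assume v: "v < N"
      then show ?thesis using val[OF v] by (simp add: old keep) (simp add: val'_def)
    next
      fix j assume "j < n" "v = N + j"
      then show ?thesis using tsN by (simp add: new val'_def)
    qed
    then have "valuation ?G ?lab x val'"
      unfolding valuation_netlist_graph[OF nl'] lN by blast
    moreover have "map (\<lambda>f. f x) fs ! j = val' v" if "v \<in> verts ?G" "?lab v = Output j" for v j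
    proof -
      have v: "v = N + j" "j < n" using that by (auto simp: verts lab_out)
      then show ?thesis using arg_cong[OF vts, of "\<lambda>ys. ys ! j"] lf by (simp add: val'_def)
    qed
    ultimately show "\<exists>val. valuation ?G ?lab x val \<and>
        (\<forall>v\<in>verts ?G. \<forall>j. ?lab v = Output j \<longrightarrow> map (\<lambda>f. f x) fs ! j = val v)" by blast
  qed
  with circ show thesis using that by blast
qed

lemma io_function_length:
  assumes "circuit G lab m n"
  shows "length (io_function G lab n x) = n"
  using theI'[OF io_function_ex1[OF assms]] by (simp add: io_function_def)

lemma balanced_circuit_morphisms:
  "{f \<in> tflRM. domC f = {[]} \<longleftrightarrow> imC f = {[]}} = circuit_morphisms"
proof (intro equalityI subsetI)
  fix f assume "f \<in> circuit_morphisms"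
  then obtain G lab m n where c: "circuit G lab m n" "f = extend_to_morphism m (io_function G lab n)"
    by (auto simp: circuit_morphisms_def)
  have "word_map m n (io_function G lab n)"
    using io_function_length[OF c(1)] by (simp add: word_map_def)
  then show "f \<in> {f \<in> tflRM. domC f = {[]} \<longleftrightarrow> imC f = {[]}}"
    unfolding c(2) using circuit_boundary[OF c(1)] by (rule balancedI)
next
  fix f assume "f \<in> {f \<in> tflRM. domC f = {[]} \<longleftrightarrow> imC f = {[]}}"
  then obtain m n F where F: "word_map m n F" "m = 0 \<longleftrightarrow> n = 0" "f = extend_to_morphism m F"
    by (rule balancedE)
  have "\<exists>fs. realizable m fs \<and> length fs = n \<and> (\<forall>x. length x = m \<longrightarrow> map (\<lambda>f. f x) fs = F x)"
  proof (cases "m = 0")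
    case True
    then show ?thesis
      using F(1,2) realizable.inputs[of 0] by (intro exI[of _ "[]"]) (auto simp: word_map_def)
  next
    case False
    then show ?thesis using realizable_universal[OF F(1)] F(2) by (metis not_gr_zero)
  qed
  then obtain fs where fs: "realizable m fs" "length fs = n"
      "\<And>x. length x = m \<Longrightarrow> map (\<lambda>f. f x) fs = F x" by blast
  obtain gs ts where "open_circuit m gs ts fs" using realizable_open_circuit[OF fs(1)] by blast
  then obtain G lab where c: "circuit G lab m n" "\<And>x. io_function G lab n x = map (\<lambda>f. f x) fs"
    using open_circuit_closed fs(2) by metis
  have "f = extend_to_morphism m (io_function G lab n)"
    unfolding F(3) using fs(3) c(2) by (intro extend_to_morphism_cong) simp
  with c(1) show "f \<in> circuit_morphisms" unfolding circuit_morphisms_def by blast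
qed

theorem proposition3p9:
  shows "{f \<in> tflRM. domC f = {[]} \<longleftrightarrow> imC f = {[]}} = circuit_morphisms
    \<and> (\<exists>\<Gamma>. finite \<Gamma> \<and> generated_monoid (\<Gamma> \<union> transpositions) = tflRM)
    \<and> generated_monoid ({not_gate, and_gate, or_gate, fork_gate} \<union> transpositions)
        = {f \<in> tflRM. domC f = {[]} \<longleftrightarrow> imC f = {[]}}"
proof (intro conjI)
  show "\<exists>\<Gamma>. finite \<Gamma> \<and> generated_monoid (\<Gamma> \<union> transpositions) = tflRM"
    by (rule exI, rule conjI[OF _ tflRM_finitely_generated]) simp
qed (rule balanced_circuit_morphisms balanced_monoid_generated)+

end
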